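(* Let $d\ge 2$, $D=(0,1)^d$ and $a=f=1$. Let $u\in H^1_0(D)$ be the weak solution of $-\Delta u=1$ on $D$, $u=0$ on $\partial D$. If $\beta<2$, then the triplet $(D,a,f)$ does not satisfy the positivity condition $\mathbf{PC}(\beta)$; that is, there is no constant $c>0$ such that $$|\nabla u(x)|^2+u(x)\ge c\,\mathrm{dist}(x,\partial D)^\beta\quad\text{for a.e. }x\in D.$$
   Context: In general, for a domain $D$, a diffusion coefficient $a$ and a right side $f$ with weak solution $u_a\in H^1_0(D)$ of $-\mathrm{div}(a\nabla u_a)=f$ on $D$, $u_a=0$ on $\partial D$, the positivity condition $\mathbf{PC}(\beta)$ ($\beta\ge0$) means that there is $c>0$ with $a(x)|\nabla u_a(x)|^2+f(x)u_a(x)\ge c\,\mathrm{dist}(x,\partial D)^\beta$ for a.e. $x\in D$. *)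

theory Defs
  imports "HOL-Analysis.Analysis"
begin

text \<open>
  Sobolev-space notions on an open set \<open>D\<close>. Functions are total, but only their values on \<open>D\<close>,
  up to Lebesgue null sets, are relevant. Weak gradients are treated relationally (as in
  \<open>has_derivative\<close>), because they are determined only almost everywhere.
\<close>

text \<open>\<open>k\<close> times continuously differentiable on the whole space, via iterated partial derivatives.\<close>

primrec cont_diff :: "nat \<Rightarrow> ('a::euclidean_space \<Rightarrow> real) \<Rightarrow> bool" where
  "cont_diff 0 \<phi> \<longleftrightarrow> continuous_on UNIV \<phi>"
| "cont_diff (Suc k) \<phi> \<longleftrightarrow> (\<forall>x. \<phi> differentiable (at x)) \<and>
     (\<forall>b\<in>Basis. cont_diff k (\<lambda>x. frechet_derivative \<phi> (at x) b))"

definition gradient :: "('a::euclidean_space \<Rightarrow> real) \<Rightarrow> 'a \<Rightarrow> 'a" where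
  "gradient \<phi> x = (\<Sum>b\<in>Basis. frechet_derivative \<phi> (at x) b *\<^sub>R b)"

text \<open>\<open>C\<^sub>c\<^sup>\<infinity>(D)\<close>, its members being extended by zero outside \<open>D\<close>.\<close>

definition test_function :: "'a::euclidean_space set \<Rightarrow> ('a \<Rightarrow> real) \<Rightarrow> bool" where
  "test_function D \<phi> \<longleftrightarrow> (\<forall>k. cont_diff k \<phi>) \<and>
     compact (closure {x. \<phi> x \<noteq> 0}) \<and> closure {x. \<phi> x \<noteq> 0} \<subseteq> D"

definition locally_integrable :: "'a::euclidean_space set \<Rightarrow> ('a \<Rightarrow> 'b::euclidean_space) \<Rightarrow> bool" where
  "locally_integrable D f \<longleftrightarrow> (\<forall>K. compact K \<and> K \<subseteq> D \<longrightarrow> f absolutely_integrable_on K)"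

definition has_weak_gradient :: "'a::euclidean_space set \<Rightarrow> ('a \<Rightarrow> real) \<Rightarrow> ('a \<Rightarrow> 'a) \<Rightarrow> bool" where
  "has_weak_gradient D u g \<longleftrightarrow> locally_integrable D u \<and> locally_integrable D g \<and>
     (\<forall>\<phi>. test_function D \<phi> \<longrightarrow> (\<forall>b\<in>Basis.
        (LINT x|lebesgue_on D. u x * frechet_derivative \<phi> (at x) b) =
        - (LINT x|lebesgue_on D. (g x \<bullet> b) * \<phi> x)))"

definition L2_function :: "'a::euclidean_space set \<Rightarrow> ('a \<Rightarrow> 'b::euclidean_space) \<Rightarrow> bool" where
  "L2_function D f \<longleftrightarrow> f \<in> borel_measurable (lebesgue_on D) \<and>
     integrable (lebesgue_on D) (\<lambda>x. (norm (f x))\<^sup>2)"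

text \<open>\<open>H1 D u g\<close> means \<open>u \<in> H\<^sup>1(D)\<close> with weak gradient \<open>g\<close>.\<close>

definition H1 :: "'a::euclidean_space set \<Rightarrow> ('a \<Rightarrow> real) \<Rightarrow> ('a \<Rightarrow> 'a) \<Rightarrow> bool" where
  "H1 D u g \<longleftrightarrow> L2_function D u \<and> L2_function D g \<and> has_weak_gradient D u g"

text \<open>
  \<open>H10 D u g\<close> means \<open>u \<in> H\<^sup>1\<^sub>0(D)\<close> with weak gradient \<open>g\<close>, where \<open>H\<^sup>1\<^sub>0(D)\<close> is the closure of
  \<open>C\<^sub>c\<^sup>\<infinity>(D)\<close> in the \<open>H\<^sup>1(D)\<close> norm.
\<close>

definition H10 :: "'a::euclidean_space set \<Rightarrow> ('a \<Rightarrow> real) \<Rightarrow> ('a \<Rightarrow> 'a) \<Rightarrow> bool" where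
  "H10 D u g \<longleftrightarrow> H1 D u g \<and>
     (\<exists>\<phi>::nat \<Rightarrow> 'a \<Rightarrow> real. (\<forall>k. test_function D (\<phi> k)) \<and>
        (\<lambda>k. LINT x|lebesgue_on D.
           (u x - \<phi> k x)\<^sup>2 + (norm (g x - gradient (\<phi> k) x))\<^sup>2) \<longlonglongrightarrow> 0)"

text \<open>
  \<open>u\<close>, with weak gradient \<open>g\<close>, is a weak solution of \<open>-div(a \<nabla>u) = f\<close> in \<open>D\<close>, \<open>u = 0\<close> on the
  boundary. The integrability conditions hold automatically for bounded measurable \<open>a\<close> and \<open>f\<close> on
  bounded \<open>D\<close>; they exclude the default value 0 of undefined integrals in the general case.
\<close>

definition weak_solution ::
  "'a::euclidean_space set \<Rightarrow> ('a \<Rightarrow> real) \<Rightarrow> ('a \<Rightarrow> real) \<Rightarrow> ('a \<Rightarrow> real) \<Rightarrow> ('a \<Rightarrow> 'a) \<Rightarrow> bool" where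
  "weak_solution D a f u g \<longleftrightarrow> H10 D u g \<and>
     (\<forall>v h. H10 D v h \<longrightarrow>
        integrable (lebesgue_on D) (\<lambda>x. a x * (g x \<bullet> h x)) \<and>
        integrable (lebesgue_on D) (\<lambda>x. f x * v x) \<and>
        (LINT x|lebesgue_on D. a x * (g x \<bullet> h x)) = (LINT x|lebesgue_on D. f x * v x))"

text \<open>
  The condition \<open>PC(\<beta>)\<close> (for \<open>\<beta> \<ge> 0\<close>) on the triplet \<open>(D, a, f)\<close>. In the elliptic setting, the
  weak solution and its weak gradient are unique up to null sets, so that the choice
  of representatives \<open>u\<close> and \<open>g\<close> does not matter.
\<close>

definition positivity_condition ::
  "'a::euclidean_space set \<Rightarrow> ('a \<Rightarrow> real) \<Rightarrow> ('a \<Rightarrow> real) \<Rightarrow> real \<Rightarrow> bool" where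
  "positivity_condition D a f \<beta> \<longleftrightarrow> (\<exists>u g. weak_solution D a f u g \<and>
     (\<exists>c>0. AE x in lebesgue_on D.
        a x * (norm (g x))\<^sup>2 + f x * u x \<ge> c * infdist x (frontier D) powr \<beta>))"

definition unit_cube :: "(real ^ 'n) set" where
  "unit_cube = {x. \<forall>i. 0 < x $ i \<and> x $ i < 1}"

end

theory Submission
  imports Defs
begin

text \<open>
  Near an edge of the cube, where two coordinates vanish, let \<open>X\<close>, \<open>Y\<close> be these coordinates shifted
  by a small \<open>e > 0\<close>, let \<open>R = X\<^sup>2 + Y\<^sup>2\<close>, and let \<open>w = R powr (- p)\<close> with \<open>1 < p < 2\<close>. Testing the
  equation with \<open>u w\<close> gives \<open>\<integral> w |\<nabla>u|\<^sup>2 + u \<nabla>w \<bullet> \<nabla>u = \<integral> u w\<close>. Adding the null Lagrangian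
  \<open>\<integral> div (u\<^sup>2 H) = 0\<close> with a suitable field \<open>H\<close> yields the Hardy-type inequality
  \<open>(4 - p\<^sup>2) \<integral> u\<^sup>2 w / R \<le> \<integral> u w\<close>; its constant is positive because the opening angle is \<open>\<pi>/2\<close>. As
  \<open>R powr (1 - p)\<close> is integrable uniformly in \<open>e\<close>, Young's inequality bounds \<open>\<integral> (|\<nabla>u|\<^sup>2 + u) w\<close>
  uniformly in \<open>e\<close>. On a box of width \<open>t\<close> in both coordinates, at distance of order \<open>t\<close> from the
  edge, a lower bound \<open>c dist powr \<beta>\<close> would contribute at least a multiple of
  \<open>t powr (\<beta> - 2 p + 2)\<close> for \<open>e = t\<close>, which is unbounded as \<open>t \<rightarrow> 0\<close> once \<open>\<beta> + 2 < 2 p < 4\<close>.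
\<close>

subsection \<open>Smooth functions on open sets\<close>

text \<open>Local counterpart of \<open>cont_diff\<close>, required because the multipliers used
  later are negative powers that are smooth only where their bases are positive. Derivatives are
  full-space derivatives \<open>at x\<close>, so the notion is meant for open
  \<open>S\<close>.\<close>

primrec cont_diff_on :: "nat \<Rightarrow> 'a::euclidean_space set \<Rightarrow> ('a \<Rightarrow> real) \<Rightarrow> bool" where
  "cont_diff_on 0 S f \<longleftrightarrow> continuous_on S f"
| "cont_diff_on (Suc k) S f \<longleftrightarrow> (\<forall>x\<in>S. f differentiable (at x)) \<and>
     (\<forall>b\<in>Basis. cont_diff_on k S (\<lambda>x. frechet_derivative f (at x) b))"

lemma cont_diff_on_UNIV: "cont_diff_on k UNIV f \<longleftrightarrow> cont_diff k f"
  by (induction k arbitrary: f) auto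

lemma cont_diff_on_subset: "cont_diff_on k T f \<Longrightarrow> S \<subseteq> T \<Longrightarrow> cont_diff_on k S f"
  by (induction k arbitrary: f) (auto intro: continuous_on_subset)

lemma cont_diff_on_cong:
  assumes "open S" "cont_diff_on k S f" "\<And>x. x \<in> S \<Longrightarrow> f x = g x"
  shows "cont_diff_on k S g"
  using assms(2,3)
proof (induction k arbitrary: f g)
  case 0
  then show ?case using continuous_on_cong by force
next
  case (Suc k)
  have "g differentiable (at x)" if "x \<in> S" for x
    using Suc.prems that assms(1) has_derivative_transform_within_open
    unfolding differentiable_def cont_diff_on.simps by blast
  moreover have "frechet_derivative f (at x) = frechet_derivative g (at x)" if "x \<in> S" for x
    using Suc.prems that assms(1) by (intro frechet_derivative_transform_within_open) auto
  ultimately show ?case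
    using Suc by (auto intro: Suc.IH[of "\<lambda>x. frechet_derivative f (at x) b" for b])
qed

text \<open>Lets the derivative be supplied in closed form: on the open set \<open>S\<close> it
  coincides with \<open>frechet_derivative\<close>, and smoothness only sees values on
  \<open>S\<close>.\<close>

lemma cont_diff_on_SucI:
  assumes "open S" "\<And>x. x \<in> S \<Longrightarrow> (f has_derivative f' x) (at x)"
    and "\<And>b. b \<in> Basis \<Longrightarrow> cont_diff_on k S (\<lambda>x. f' x b)"
  shows "cont_diff_on (Suc k) S f"
  unfolding cont_diff_on.simps
proof (intro conjI ballI)
  show "f differentiable (at x)" if "x \<in> S" for x
    using assms(2)[OF that] differentiable_def by blast
  show "cont_diff_on k S (\<lambda>x. frechet_derivative f (at x) b)" if "b \<in> Basis" for b
    using assms(3)[OF that] by (rule cont_diff_on_cong[OF assms(1)])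
      (use assms(2) frechet_derivative_at in metis)
qed

lemma cont_diff_on_Suc_has_derivative:
  "cont_diff_on (Suc k) S f \<Longrightarrow> x \<in> S \<Longrightarrow> (f has_derivative frechet_derivative f (at x)) (at x)"
  by (simp add: frechet_derivative_works)

lemma cont_diff_on_Suc_continuous: "cont_diff_on (Suc k) S f \<Longrightarrow> continuous_on S f"
  by (meson continuous_at_imp_continuous_on cont_diff_on_Suc_has_derivative has_derivative_continuous)

lemma cont_diff_on_Suc_mono: "cont_diff_on (Suc k) S f \<Longrightarrow> cont_diff_on k S f"
proof (induction k arbitrary: f)
  case 0
  then show ?case by (metis cont_diff_on_Suc_continuous cont_diff_on.simps(1))
next
  case (Suc k)
  then show ?case by (metis cont_diff_on.simps(2))
qed

lemma cont_diff_on_const: "cont_diff_on k S (\<lambda>x. c)"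
  by (induction k arbitrary: c) auto

lemma cont_diff_on_add:
  assumes "open S"
  shows "cont_diff_on k S f \<Longrightarrow> cont_diff_on k S g \<Longrightarrow> cont_diff_on k S (\<lambda>x. f x + g x)"
proof (induction k arbitrary: f g)
  case 0
  then show ?case by (auto intro: continuous_intros)
next
  case (Suc k)
  show ?case
  proof (rule cont_diff_on_SucI[OF assms])
    show "((\<lambda>x. f x + g x) has_derivative
        (\<lambda>h. frechet_derivative f (at x) h + frechet_derivative g (at x) h)) (at x)" if "x \<in> S" for x
      using Suc.prems that by (intro derivative_intros cont_diff_on_Suc_has_derivative)
  qed (use Suc in simp)
qed

lemma cont_diff_on_mult:
  assumes "open S"
  shows "cont_diff_on k S f \<Longrightarrow> cont_diff_on k S g \<Longrightarrow> cont_diff_on k S (\<lambda>x. f x * g x)"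
proof (induction k arbitrary: f g)
  case 0
  then show ?case by (auto intro: continuous_intros)
next
  case (Suc k)
  show ?case
  proof (rule cont_diff_on_SucI[OF assms])
    show "((\<lambda>x. f x * g x) has_derivative
        (\<lambda>h. f x * frechet_derivative g (at x) h + frechet_derivative f (at x) h * g x)) (at x)"
      if "x \<in> S" for x
      using Suc.prems that by (intro derivative_intros cont_diff_on_Suc_has_derivative)
    show "cont_diff_on k S (\<lambda>x. f x * frechet_derivative g (at x) b + frechet_derivative f (at x) b * g x)"
      if "b \<in> Basis" for b
      using Suc.prems[THEN cont_diff_on_Suc_mono] Suc.prems that
      by (intro cont_diff_on_add assms Suc.IH) simp_all
  qed
qed

text \<open>Differentiation reproduces a power of \<open>f\<close> with exponent
  \<open>a - 1\<close>, times a derivative of \<open>f\<close>; hence the induction on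
  \<open>k\<close> must leave \<open>a\<close> arbitrary.\<close>

lemma cont_diff_on_powr:
  assumes "open S" "\<And>x. x \<in> S \<Longrightarrow> f x > 0"
  shows "cont_diff_on k S f \<Longrightarrow> cont_diff_on k S (\<lambda>x. f x powr a)"
proof (induction k arbitrary: a)
  case 0
  with assms show ?case by (auto intro!: continuous_intros) force
next
  case (Suc k)
  show ?case
  proof (rule cont_diff_on_SucI[OF assms(1)])
    show "((\<lambda>x. f x powr a) has_derivative
        (\<lambda>h. (a * f x powr (a - 1)) * frechet_derivative f (at x) h)) (at x)" if "x \<in> S" for x
      using assms(2)[OF that] Suc.prems that
      by (auto intro!: derivative_eq_intros cont_diff_on_Suc_has_derivative[of k S f]
          simp: powr_diff field_simps simp del: cont_diff_on.simps)
    show "cont_diff_on k S (\<lambda>x. a * f x powr (a - 1) * frechet_derivative f (at x) b)"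
      if "b \<in> Basis" for b
      using Suc.prems[THEN cont_diff_on_Suc_mono] Suc.prems that
      by (intro cont_diff_on_mult cont_diff_on_const assms Suc.IH) simp_all
  qed
qed

lemma cont_diff_on_inner_left: "cont_diff_on k S (\<lambda>x. x \<bullet> v)"
proof (cases k)
  case (Suc l)
  have "frechet_derivative (\<lambda>x. x \<bullet> v) (at x) = (\<lambda>h. h \<bullet> v)" for x
    by (rule frechet_derivative_at[symmetric]) (auto intro!: derivative_eq_intros)
  moreover have "(\<lambda>x. x \<bullet> v) differentiable (at x)" for x
    by (auto simp: differentiable_def intro!: derivative_eq_intros)
  ultimately show ?thesis
    using Suc by (simp add: cont_diff_on_const)
qed (auto intro: continuous_intros)

text \<open>The open sets \<open>S\<close> and \<open>- K\<close> cover the space, and on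
  \<open>- K\<close> the function and its derivatives vanish. Vanishing off \<open>K\<close> passes
  to each partial derivative, which keeps the induction going.\<close>

lemma cont_diff_extend_by_zero:
  assumes "open S" "closed K" "K \<subseteq> S"
  shows "cont_diff_on k S f \<Longrightarrow> (\<And>x. x \<notin> K \<Longrightarrow> f x = 0) \<Longrightarrow> cont_diff k f"
proof (induction k arbitrary: f)
  have ext: "(f has_derivative (\<lambda>_. 0)) (at x)" if "x \<notin> K" and "\<And>x. x \<notin> K \<Longrightarrow> f x = 0" for f::"_\<Rightarrow>real" and x
  proof (rule has_derivative_transform_within_open[of "\<lambda>_. 0" _ _ UNIV "- K"])
    show "open (- K)" using assms by auto
  qed (use that in auto)
  {
    case 0
    have "continuous_on (S \<union> - K) f"
    proof (rule continuous_on_open_Un)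
      show "continuous_on (- K) f"
        using 0(2) by (metis (full_types) ComplD continuous_on_cong continuous_on_const)
    qed (use 0 assms in auto)
    moreover have "S \<union> - K = UNIV" using assms by auto
    ultimately show ?case by simp
  next
    case (Suc k)
    have "f differentiable (at x)" for x
    proof (cases "x \<in> K")
      case True
      then show ?thesis using Suc.prems(1) assms(3) by auto
    next
      case False
      from ext[OF this Suc.prems(2)] show ?thesis by (rule differentiableI)
    qed
    moreover have "cont_diff k (\<lambda>x. frechet_derivative f (at x) b)" if "b \<in> Basis" for b
    proof (rule Suc.IH)
      show "frechet_derivative f (at x) b = 0" if "x \<notin> K" for x
        using frechet_derivative_at[OF ext[OF that Suc.prems(2)]] by (simp add: fun_eq_iff)
    qed (use Suc.prems that in auto)
    ultimately show ?case by simp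
  }
qed

section \<open>Smooth functions, their gradients and products with test functions\<close>

definition smooth_on :: "'a::euclidean_space set \<Rightarrow> ('a \<Rightarrow> real) \<Rightarrow> bool" where
  "smooth_on S f \<longleftrightarrow> (\<forall>k. cont_diff_on k S f)"

lemma smooth_on_subset: "smooth_on T f \<Longrightarrow> S \<subseteq> T \<Longrightarrow> smooth_on S f"
  by (auto simp: smooth_on_def intro: cont_diff_on_subset)

lemma smooth_on_cong:
  "open S \<Longrightarrow> smooth_on S f \<Longrightarrow> (\<And>x. x \<in> S \<Longrightarrow> f x = g x) \<Longrightarrow> smooth_on S g"
  unfolding smooth_on_def using cont_diff_on_cong by blast

lemma smooth_on_const: "smooth_on S (\<lambda>x. c)"
  and smooth_on_inner_left: "smooth_on S (\<lambda>x. x \<bullet> v)"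
  and smooth_on_add: "open S \<Longrightarrow> smooth_on S f \<Longrightarrow> smooth_on S g \<Longrightarrow> smooth_on S (\<lambda>x. f x + g x)"
  and smooth_on_mult: "open S \<Longrightarrow> smooth_on S f \<Longrightarrow> smooth_on S g \<Longrightarrow> smooth_on S (\<lambda>x. f x * g x)"
  and smooth_on_powr: "open S \<Longrightarrow> (\<And>x. x \<in> S \<Longrightarrow> f x > 0) \<Longrightarrow> smooth_on S f \<Longrightarrow> smooth_on S (\<lambda>x. f x powr a)"
  by (auto simp: smooth_on_def cont_diff_on_const cont_diff_on_inner_left cont_diff_on_add
      cont_diff_on_mult cont_diff_on_powr)

lemma smooth_on_has_derivative:
  "smooth_on S f \<Longrightarrow> x \<in> S \<Longrightarrow> (f has_derivative frechet_derivative f (at x)) (at x)"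
  using cont_diff_on_Suc_has_derivative smooth_on_def by blast

lemma smooth_on_imp_continuous_on: "smooth_on S f \<Longrightarrow> continuous_on S f"
  by (metis cont_diff_on.simps(1) smooth_on_def)

lemma gradient_inner_Basis: "b \<in> Basis \<Longrightarrow> gradient f x \<bullet> b = frechet_derivative f (at x) b"
  by (simp add: gradient_def)

lemma gradient_inner:
  assumes "(f has_derivative f') (at x)"
  shows "gradient f x \<bullet> v = f' v"
proof -
  interpret linear f' using assms by (rule has_derivative_linear)
  have "gradient f x \<bullet> v = (\<Sum>b\<in>Basis. (v \<bullet> b) *\<^sub>R f' b)"
    by (simp add: gradient_def frechet_derivative_at[OF assms, symmetric] inner_sum_left inner_commute[of v] mult.commute)
  also have "\<dots> = f' (\<Sum>b\<in>Basis. (v \<bullet> b) *\<^sub>R b)"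
    by (simp add: sum scaleR)
  finally show ?thesis by (simp add: euclidean_representation)
qed

lemma smooth_on_imp_continuous_on_gradient:
  assumes "smooth_on S f"
  shows "continuous_on S (gradient f)"
proof -
  have "cont_diff_on (Suc 0) S f" using assms smooth_on_def by blast
  then show ?thesis
    unfolding gradient_def by (auto intro!: continuous_intros)
qed

lemma gradient_mult:
  assumes "(f has_derivative frechet_derivative f (at x)) (at x)"
    and "(g has_derivative frechet_derivative g (at x)) (at x)"
  shows "gradient (\<lambda>x. f x * g x) x = g x *\<^sub>R gradient f x + f x *\<^sub>R gradient g x"
proof -
  have "frechet_derivative (\<lambda>x. f x * g x) (at x) =
      (\<lambda>h. f x * frechet_derivative g (at x) h + frechet_derivative f (at x) h * g x)"
    by (rule frechet_derivative_at[symmetric]) (intro derivative_intros assms)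
  then show ?thesis
    by (simp add: gradient_def scaleR_sum_right sum.distrib algebra_simps)
qed

lemma test_function_smooth_on: "test_function D \<phi> \<Longrightarrow> smooth_on S \<phi>"
  unfolding test_function_def smooth_on_def
  by (metis cont_diff_on_UNIV cont_diff_on_subset top_greatest)

text \<open>The factor \<open>f\<close> is controlled on \<open>D\<close> only, but the product
  vanishes off the compact support of \<open>\<phi>\<close> inside \<open>D\<close>, so extension by
  zero gives smoothness on the whole space.\<close>

lemma test_function_mult:
  assumes "open D" "test_function D \<phi>" "smooth_on D f"
  shows "test_function D (\<lambda>x. \<phi> x * f x)"
proof -
  let ?K = "closure {x. \<phi> x \<noteq> 0}"
  have K: "compact ?K" "?K \<subseteq> D" using assms by (auto simp: test_function_def)
  have sub: "closure {x. \<phi> x * f x \<noteq> 0} \<subseteq> ?K" by (intro closure_mono) auto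
  have "cont_diff k (\<lambda>x. \<phi> x * f x)" for k
  proof (rule cont_diff_extend_by_zero[OF assms(1) _ K(2)])
    show "cont_diff_on k D (\<lambda>x. \<phi> x * f x)"
      using smooth_on_mult[OF assms(1) test_function_smooth_on[OF assms(2)] assms(3)]
      by (auto simp: smooth_on_def)
    show "\<phi> x * f x = 0" if "x \<notin> ?K" for x
      using that closure_subset[of "{x. \<phi> x \<noteq> 0}"] by auto
  qed auto
  moreover have "compact (closure {x. \<phi> x * f x \<noteq> 0})"
    using sub K(1) by (meson closed_closure closed_subset compact_eq_bounded_closed bounded_subset)
  ultimately show ?thesis
    using sub K(2) by (auto simp: test_function_def)
qed

subsection \<open>Smooth multipliers on Sobolev spaces\<close>

lemma L2_function_measurable: "L2_function D f \<Longrightarrow> f \<in> borel_measurable (lebesgue_on D)"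
  and L2_function_square_integrable: "L2_function D f \<Longrightarrow> integrable (lebesgue_on D) (\<lambda>x. (norm (f x))\<^sup>2)"
  by (auto simp: L2_function_def)

lemma L2_function_integrable_inner:
  assumes "L2_function D f" "L2_function D g"
  shows "integrable (lebesgue_on D) (\<lambda>x. f x \<bullet> g x)"
proof (rule Bochner_Integration.integrable_bound)
  show "integrable (lebesgue_on D) (\<lambda>x. (norm (f x))\<^sup>2 + (norm (g x))\<^sup>2)"
    using assms by (simp add: L2_function_def)
  show "(\<lambda>x. f x \<bullet> g x) \<in> borel_measurable (lebesgue_on D)"
    using assms[THEN L2_function_measurable] by measurable
  have "\<bar>f x \<bullet> g x\<bar> \<le> (norm (f x))\<^sup>2 + (norm (g x))\<^sup>2" for x
    using Cauchy_Schwarz_ineq2[of "f x" "g x"] sum_squares_bound[of "norm (f x)" "norm (g x)"]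
      mult_nonneg_nonneg[OF norm_ge_zero[of "f x"] norm_ge_zero[of "g x"]] by linarith
  then show "AE x in lebesgue_on D. norm (f x \<bullet> g x) \<le> norm ((norm (f x))\<^sup>2 + (norm (g x))\<^sup>2)"
    by auto
qed

lemmas L2_function_integrable_mult = L2_function_integrable_inner[where 'b = real, unfolded inner_real_def]

lemma L2_function_add:
  assumes "L2_function D f" "L2_function D g"
  shows "L2_function D (\<lambda>x. f x + g x)"
  unfolding L2_function_def
proof
  have "(norm (f x + g x))\<^sup>2 = (norm (f x))\<^sup>2 + 2 * (f x \<bullet> g x) + (norm (g x))\<^sup>2" for x
    by (simp add: power2_norm_eq_inner inner_add inner_commute)
  then show "integrable (lebesgue_on D) (\<lambda>x. (norm (f x + g x))\<^sup>2)"
    using assms by (simp add: L2_function_integrable_inner L2_function_square_integrable)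
qed (intro borel_measurable_add assms[THEN L2_function_measurable])

lemma L2_function_scaleR_bounded:
  assumes "L2_function D f" "h \<in> borel_measurable (lebesgue_on D)" "\<And>x. x \<in> D \<Longrightarrow> \<bar>h x\<bar> \<le> B"
  shows "L2_function D (\<lambda>x. h x *\<^sub>R f x)"
  unfolding L2_function_def
proof
  show "integrable (lebesgue_on D) (\<lambda>x. (norm (h x *\<^sub>R f x))\<^sup>2)"
  proof (rule Bochner_Integration.integrable_bound)
    show "integrable (lebesgue_on D) (\<lambda>x. B\<^sup>2 * (norm (f x))\<^sup>2)"
      using assms by (simp add: L2_function_def)
    have "(norm (h x *\<^sub>R f x))\<^sup>2 \<le> B\<^sup>2 * (norm (f x))\<^sup>2" if "x \<in> D" for x
      using assms(3)[OF that] by (auto simp: power_mult_distrib intro!: mult_right_mono)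
        (metis abs_le_square_iff abs_ge_self order_trans power2_abs)
    then show "AE x in lebesgue_on D. norm ((norm (h x *\<^sub>R f x))\<^sup>2) \<le> norm (B\<^sup>2 * (norm (f x))\<^sup>2)"
      by (intro AE_I2) (auto simp: space_restrict_space)
  qed (use L2_function_measurable[OF assms(1)] assms(2) in measurable)
qed (use L2_function_measurable[OF assms(1)] assms(2) in measurable)

lemma L2_function_diff:
  "L2_function D f \<Longrightarrow> L2_function D g \<Longrightarrow> L2_function D (\<lambda>x. f x - g x)"
  using L2_function_add[of D f "\<lambda>x. (-1) *\<^sub>R g x"] L2_function_scaleR_bounded[of D g "\<lambda>_. -1" 1]
  by simp

lemma L2_function_inner_const:
  assumes "L2_function D g"
  shows "L2_function D (\<lambda>x. g x \<bullet> b)"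
  unfolding L2_function_def
proof
  show "integrable (lebesgue_on D) (\<lambda>x. (norm (g x \<bullet> b))\<^sup>2)"
  proof (rule Bochner_Integration.integrable_bound)
    show "integrable (lebesgue_on D) (\<lambda>x. (norm (g x))\<^sup>2 * (norm b)\<^sup>2)"
      using assms by (simp add: L2_function_def)
    have "(norm (g x \<bullet> b))\<^sup>2 \<le> (norm (g x))\<^sup>2 * (norm b)\<^sup>2" for x
      unfolding power_mult_distrib[symmetric] by (intro power_mono) (auto intro: Cauchy_Schwarz_ineq2)
    then show "AE x in lebesgue_on D. norm ((norm (g x \<bullet> b))\<^sup>2) \<le> norm ((norm (g x))\<^sup>2 * (norm b)\<^sup>2)"
      by (intro AE_I2) simp
  qed (use L2_function_measurable[OF assms] in measurable)
qed (use L2_function_measurable[OF assms] in measurable)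

lemma continuous_on_imp_L2_function:
  fixes f :: "'a::euclidean_space \<Rightarrow> 'b::euclidean_space"
  assumes "open D" "bounded D" "continuous_on D f" "\<And>x. x \<in> D \<Longrightarrow> norm (f x) \<le> B"
  shows "L2_function D f"
  unfolding L2_function_def
proof
  have D: "D \<in> lmeasurable" using assms(1,2) by (simp add: lmeasurable_open)
  show f: "f \<in> borel_measurable (lebesgue_on D)"
    using assms(1,3) by (simp add: continuous_imp_measurable_on_sets_lebesgue borel_open)
  interpret finite_measure "lebesgue_on D"
    by (rule finite_measure_lebesgue_on[OF D])
  show "integrable (lebesgue_on D) (\<lambda>x. (norm (f x))\<^sup>2)"
  proof (rule integrable_const_bound)
    show "AE x in lebesgue_on D. norm ((norm (f x))\<^sup>2) \<le> B\<^sup>2"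
      using assms(4) by (intro AE_I2) (auto simp: space_restrict_space intro!: power_mono)
  qed (use f in measurable)
qed

text \<open>A bounded open set has finite measure, and |f| \<le> 1 + |f|^2 gives integrability on
  all of \<open>D\<close>, hence on compact subsets.\<close>

lemma L2_function_locally_integrable:
  assumes "open D" "bounded D" "L2_function D f"
  shows "locally_integrable D f"
  unfolding locally_integrable_def
proof (intro allI impI)
  fix K assume K: "compact K \<and> K \<subseteq> D"
  have D: "D \<in> lmeasurable" using assms(1,2) by (simp add: lmeasurable_open)
  interpret finite_measure "lebesgue_on D"
    by (rule finite_measure_lebesgue_on[OF D])
  have "integrable (lebesgue_on D) f"
  proof (rule Bochner_Integration.integrable_bound)
    show "integrable (lebesgue_on D) (\<lambda>x. 1 + (norm (f x))\<^sup>2)"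
      using assms(3) by (simp add: L2_function_def)
    have "norm (f x) \<le> 1 + (norm (f x))\<^sup>2" for x
      using sum_squares_bound[of 1 "norm (f x)"] norm_ge_zero[of "f x"] unfolding power2_eq_square by linarith
    then show "AE x in lebesgue_on D. norm (f x) \<le> norm (1 + (norm (f x))\<^sup>2)"
      by (intro AE_I2) (smt (verit) real_norm_def)
  qed (use assms in \<open>simp add: L2_function_def\<close>)
  then have "f absolutely_integrable_on D"
    using D by (simp add: set_integrable_def integrable_restrict_space fmeasurableD)
  then show "f absolutely_integrable_on K"
    using K set_integrable_subset[of lebesgue D f K] by (simp add: fmeasurableD lmeasurable_compact)
qed

text \<open>Continuity of the L2 pairing in one argument. Instead of the Cauchy-Schwarz inequality
  for integrals, the pointwise Young inequality with a free parameter is integrated.\<close>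

lemma L2_function_tendsto_integral_inner:
  assumes "L2_function D a" "\<And>k. L2_function D (b k)" "L2_function D c"
    and lim: "(\<lambda>k. LINT x|lebesgue_on D. (norm (c x - b k x))\<^sup>2) \<longlonglongrightarrow> 0"
  shows "(\<lambda>k. LINT x|lebesgue_on D. a x \<bullet> b k x) \<longlonglongrightarrow> (LINT x|lebesgue_on D. a x \<bullet> c x)"
proof -
  let ?I = "\<lambda>f. LINT x|lebesgue_on D. (norm (f x))\<^sup>2"
  have bound: "2 * \<bar>(LINT x|lebesgue_on D. a x \<bullet> b k x) - (LINT x|lebesgue_on D. a x \<bullet> c x)\<bar>
      \<le> e * ?I a + ?I (\<lambda>x. c x - b k x) / e" if "e > 0" for e k
  proof -
    have i: "integrable (lebesgue_on D) (\<lambda>x. a x \<bullet> b k x)" "integrable (lebesgue_on D) (\<lambda>x. a x \<bullet> c x)"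
      "integrable (lebesgue_on D) (\<lambda>x. (norm (a x))\<^sup>2)"
      "integrable (lebesgue_on D) (\<lambda>x. (norm (c x - b k x))\<^sup>2)"
      using assms by (auto intro!: L2_function_integrable_inner L2_function_square_integrable L2_function_diff)
    have pt: "2 * \<bar>a x \<bullet> b k x - a x \<bullet> c x\<bar> \<le> e * (norm (a x))\<^sup>2 + (norm (c x - b k x))\<^sup>2 / e" for x
    proof -
      have "2 * \<bar>a x \<bullet> b k x - a x \<bullet> c x\<bar> \<le> 2 * (norm (a x) * norm (c x - b k x))"
        using Cauchy_Schwarz_ineq2[of "a x" "c x - b k x"] by (simp add: inner_diff_right)
      also have "\<dots> = 2 * (sqrt e * norm (a x)) * (norm (c x - b k x) / sqrt e)"
        using that by simp
      also have "\<dots> \<le> (sqrt e * norm (a x))\<^sup>2 + (norm (c x - b k x) / sqrt e)\<^sup>2"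
        by (rule sum_squares_bound)
      also have "\<dots> = e * (norm (a x))\<^sup>2 + (norm (c x - b k x))\<^sup>2 / e"
        using that by (simp add: power_mult_distrib power_divide)
      finally show ?thesis .
    qed
    have "\<bar>(LINT x|lebesgue_on D. a x \<bullet> b k x) - (LINT x|lebesgue_on D. a x \<bullet> c x)\<bar>
        = \<bar>LINT x|lebesgue_on D. a x \<bullet> b k x - a x \<bullet> c x\<bar>"
      using i by simp
    also have "\<dots> \<le> (LINT x|lebesgue_on D. \<bar>a x \<bullet> b k x - a x \<bullet> c x\<bar>)"
      by (rule integral_abs_bound)
    also have "2 * \<dots> = (LINT x|lebesgue_on D. 2 * \<bar>a x \<bullet> b k x - a x \<bullet> c x\<bar>)"
      by simp
    also have "\<dots> \<le> (LINT x|lebesgue_on D. e * (norm (a x))\<^sup>2 + (norm (c x - b k x))\<^sup>2 / e)"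
      using i pt by (intro integral_mono) auto
    also have "\<dots> = e * ?I a + ?I (\<lambda>x. c x - b k x) / e"
      using i by simp
    finally show ?thesis by simp
  qed
  show ?thesis
  proof (rule LIMSEQ_I)
    fix r :: real assume r: "r > 0"
    have Ia: "?I a \<ge> 0" by simp
    \<comment> \<open>This makes the first term of \<open>bound\<close> at most \<open>r\<close>,
      and the second is eventually below \<open>r\<close>; the factor 2 on the left of
      \<open>bound\<close> compensates. The summand 1 in the denominator covers a vanishing integral
      of |a|^2.\<close>
    define e where "e = r / (?I a + 1)"
    have e: "e > 0" "e * ?I a \<le> r" using r Ia
      by (auto simp: e_def divide_simps add_nonneg_pos add_nonneg_eq_0_iff distrib_left simp del: integral_nonneg_AE)
    from LIMSEQ_D[OF lim, of "r * e"] r e obtain N where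
      N: "\<And>k. k \<ge> N \<Longrightarrow> \<bar>?I (\<lambda>x. c x - b k x)\<bar> < r * e" by auto
    show "\<exists>no. \<forall>n\<ge>no. norm ((LINT x|lebesgue_on D. a x \<bullet> b n x) - (LINT x|lebesgue_on D. a x \<bullet> c x)) < r"
    proof (intro exI allI impI)
      fix k assume "N \<le> k"
      from N[OF this] e have "?I (\<lambda>x. c x - b k x) / e < r" by (simp add: field_simps)
      from le_less_trans[OF bound[OF e(1), of k] add_le_less_mono[OF e(2) this]]
      show "norm ((LINT x|lebesgue_on D. a x \<bullet> b k x) - (LINT x|lebesgue_on D. a x \<bullet> c x)) < r"
        by simp
    qed
  qed
qed

section \<open>Multipliers that are smooth up to the boundary\<close>

lemma smooth_on_bounded:
  assumes "bounded D" "closure D \<subseteq> S" "smooth_on S f"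
  obtains B where "B \<ge> 0" "\<And>x. x \<in> D \<Longrightarrow> \<bar>f x\<bar> \<le> B" "\<And>x. x \<in> D \<Longrightarrow> norm (gradient f x) \<le> B"
proof -
  have c: "compact (closure D)" using assms(1) by simp
  note cont = continuous_on_subset[OF smooth_on_imp_continuous_on[OF assms(3)] assms(2)]
    continuous_on_subset[OF smooth_on_imp_continuous_on_gradient[OF assms(3)] assms(2)]
  have "bounded (f ` closure D)" "bounded (gradient f ` closure D)"
    using cont[THEN compact_continuous_image, OF c] by (auto dest: compact_imp_bounded)
  then obtain B1 B2 where "\<And>x. x \<in> closure D \<Longrightarrow> \<bar>f x\<bar> \<le> B1" "\<And>x. x \<in> closure D \<Longrightarrow> norm (gradient f x) \<le> B2"
    unfolding bounded_iff by auto
  then show ?thesis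
    using closure_subset[of D] by (intro that[of "max 0 (max B1 B2)"]) (auto simp: le_max_iff_disj)
qed

lemma smooth_on_L2_function:
  assumes "open D" "bounded D" "closure D \<subseteq> S" "smooth_on S f"
  shows "L2_function D f" "L2_function D (gradient f)"
proof -
  obtain B where "\<And>x. x \<in> D \<Longrightarrow> \<bar>f x\<bar> \<le> B" "\<And>x. x \<in> D \<Longrightarrow> norm (gradient f x) \<le> B"
    by (rule smooth_on_bounded[OF assms(2-4)]) blast
  moreover have "smooth_on D f" using assms(3,4) closure_subset smooth_on_subset by blast
  ultimately show "L2_function D f" "L2_function D (gradient f)"
    using assms(1,2) by (auto intro!: continuous_on_imp_L2_function[where B = B]
        smooth_on_imp_continuous_on smooth_on_imp_continuous_on_gradient)
qed

lemma L2_function_scaleR_smooth: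
  assumes "open D" "bounded D" "closure D \<subseteq> S" "smooth_on S f" "L2_function D v"
  shows "L2_function D (\<lambda>x. f x *\<^sub>R v x)"
proof -
  obtain B where "\<And>x. x \<in> D \<Longrightarrow> \<bar>f x\<bar> \<le> B"
    by (rule smooth_on_bounded[OF assms(2-4)]) blast
  then show ?thesis
    by (intro L2_function_scaleR_bounded[OF assms(5), where B = B]
        L2_function_measurable[OF smooth_on_L2_function(1)[OF assms(1-4)]])
qed

lemma test_function_L2_function:
  assumes "open D" "bounded D" "test_function D \<phi>"
  shows "L2_function D \<phi>" "L2_function D (gradient \<phi>)"
  by (rule smooth_on_L2_function[OF assms(1,2) subset_UNIV test_function_smooth_on[OF assms(3)]])+

section \<open>Weak gradients, integration by parts and the product rule\<close>

lemma has_weak_gradientD: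
  assumes "has_weak_gradient D u g" "test_function D \<phi>" "b \<in> Basis"
  shows "(LINT x|lebesgue_on D. u x * (gradient \<phi> x \<bullet> b)) = - (LINT x|lebesgue_on D. (g x \<bullet> b) * \<phi> x)"
  unfolding gradient_inner_Basis[OF assms(3)]
  using assms unfolding has_weak_gradient_def by blast

text \<open>Both summands of the squared distance in \<open>H10\<close> are nonnegative and
  integrable, so each tends to 0 by itself.\<close>

lemma H10_approximation:
  assumes "open D" "bounded D" "H10 D u g"
  obtains \<phi> where "\<And>k. test_function D (\<phi> k)"
    "(\<lambda>k. LINT x|lebesgue_on D. (u x - \<phi> k x)\<^sup>2) \<longlonglongrightarrow> 0"
    "(\<lambda>k. LINT x|lebesgue_on D. (norm (g x - gradient (\<phi> k) x))\<^sup>2) \<longlonglongrightarrow> 0"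
proof -
  obtain \<phi> where \<phi>: "\<And>k. test_function D (\<phi> k)"
    and lim: "(\<lambda>k. LINT x|lebesgue_on D. (u x - \<phi> k x)\<^sup>2 + (norm (g x - gradient (\<phi> k) x))\<^sup>2) \<longlonglongrightarrow> 0"
    using assms(3) unfolding H10_def by blast
  have L2: "L2_function D u" "L2_function D g" using assms(3) by (auto simp: H10_def H1_def)
  have i: "integrable (lebesgue_on D) (\<lambda>x. (u x - \<phi> k x)\<^sup>2)"
    "integrable (lebesgue_on D) (\<lambda>x. (norm (g x - gradient (\<phi> k) x))\<^sup>2)" for k
    using L2_function_square_integrable[OF L2_function_diff[OF L2(1) test_function_L2_function(1)[OF assms(1,2) \<phi>]], of k]
      L2_function_square_integrable[OF L2_function_diff[OF L2(2) test_function_L2_function(2)[OF assms(1,2) \<phi>]], of k]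
    by simp_all
  show ?thesis
  proof (rule that[OF \<phi>])
    show "(\<lambda>k. LINT x|lebesgue_on D. (u x - \<phi> k x)\<^sup>2) \<longlonglongrightarrow> 0"
      by (rule tendsto_sandwich[OF _ _ tendsto_const lim]) (use i in \<open>auto intro!: always_eventually integral_mono\<close>)
    show "(\<lambda>k. LINT x|lebesgue_on D. (norm (g x - gradient (\<phi> k) x))\<^sup>2) \<longlonglongrightarrow> 0"
      by (rule tendsto_sandwich[OF _ _ tendsto_const lim]) (use i in \<open>auto intro!: always_eventually integral_mono\<close>)
  qed
qed

text \<open>By density: the defining identity of the weak gradient holds for test functions, and
  both sides pass to the limit along an approximating sequence of \<open>v\<close>.\<close>

lemma H1_H10_integral_by_parts:
  assumes D: "open D" "bounded D" and u: "H1 D u g" and v: "H10 D v h" and b: "b \<in> Basis"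
  shows "(LINT x|lebesgue_on D. u x * (h x \<bullet> b)) = - (LINT x|lebesgue_on D. (g x \<bullet> b) * v x)"
proof -
  obtain \<phi> where \<phi>: "\<And>k. test_function D (\<phi> k)"
    and lim: "(\<lambda>k. LINT x|lebesgue_on D. (v x - \<phi> k x)\<^sup>2) \<longlonglongrightarrow> 0"
    "(\<lambda>k. LINT x|lebesgue_on D. (norm (h x - gradient (\<phi> k) x))\<^sup>2) \<longlonglongrightarrow> 0"
    by (rule H10_approximation[OF D v]) blast
  note \<phi>L2 = test_function_L2_function[OF D \<phi>]
  have L2: "L2_function D u" "L2_function D g" "L2_function D v" "L2_function D h"
    using u v by (auto simp: H10_def H1_def)
  \<comment> \<open>The direction \<open>b\<close> is absorbed into an L2 vector field, so that
    convergence of the vector-valued gradients can be used directly.\<close>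
  have bu: "L2_function D (\<lambda>x. u x *\<^sub>R b)"
    unfolding L2_function_def
  proof
    show "(\<lambda>x. u x *\<^sub>R b) \<in> borel_measurable (lebesgue_on D)"
      using L2_function_measurable[OF L2(1)] by measurable
  qed (use L2_function_square_integrable[OF L2(1)] in \<open>simp add: power_mult_distrib\<close>)
  have "(\<lambda>k. LINT x|lebesgue_on D. (u x *\<^sub>R b) \<bullet> gradient (\<phi> k) x)
      \<longlonglongrightarrow> (LINT x|lebesgue_on D. (u x *\<^sub>R b) \<bullet> h x)"
    by (intro L2_function_tendsto_integral_inner bu \<phi>L2 L2 lim)
  then have 1: "(\<lambda>k. LINT x|lebesgue_on D. u x * (gradient (\<phi> k) x \<bullet> b))
      \<longlonglongrightarrow> (LINT x|lebesgue_on D. u x * (h x \<bullet> b))"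
    by (simp add: inner_commute)
  have "(\<lambda>k. LINT x|lebesgue_on D. (g x \<bullet> b) \<bullet> \<phi> k x) \<longlonglongrightarrow> (LINT x|lebesgue_on D. (g x \<bullet> b) \<bullet> v x)"
    using lim(1) by (intro L2_function_tendsto_integral_inner L2_function_inner_const \<phi>L2 L2) simp
  then have 2: "(\<lambda>k. - (LINT x|lebesgue_on D. (g x \<bullet> b) * \<phi> k x)) \<longlonglongrightarrow> - (LINT x|lebesgue_on D. (g x \<bullet> b) * v x)"
    by (intro tendsto_minus) simp
  have "has_weak_gradient D u g" using u by (simp add: H1_def)
  from 1[unfolded has_weak_gradientD[OF this \<phi> b]] 2 show ?thesis
    by (rule LIMSEQ_unique)
qed

text \<open>Since \<open>f\<close> and its gradient are bounded on \<open>D\<close>, multiplication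
  by \<open>f\<close> preserves L2, and the products of \<open>f\<close> with test functions
  approximating \<open>u\<close> approximate the product \<open>u f\<close>. This makes u times the
  weight an admissible test function for the weak equation.\<close>

lemma H10_mult_smooth:
  assumes D: "open D" "bounded D" and S: "closure D \<subseteq> S" and u: "H10 D u g" and f: "smooth_on S f"
  shows "H10 D (\<lambda>x. u x * f x) (\<lambda>x. f x *\<^sub>R g x + u x *\<^sub>R gradient f x)"
proof -
  obtain B where B: "B \<ge> 0" "\<And>x. x \<in> D \<Longrightarrow> \<bar>f x\<bar> \<le> B" "\<And>x. x \<in> D \<Longrightarrow> norm (gradient f x) \<le> B"
    by (rule smooth_on_bounded[OF D(2) S f]) blast
  have fD: "smooth_on D f" using f S closure_subset smooth_on_subset by blast
  note fL2 = smooth_on_L2_function[OF D S f]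
  have fm: "f \<in> borel_measurable (lebesgue_on D)" "gradient f \<in> borel_measurable (lebesgue_on D)"
    using fL2 by (auto simp: L2_function_def)
  have L2: "L2_function D u" "L2_function D g" using u by (auto simp: H10_def H1_def)
  note L2_mult = L2_function_scaleR_smooth[OF D S f]
  have L2g: "L2_function D (\<lambda>x. v x *\<^sub>R gradient f x)" if "L2_function D v" for v
    unfolding L2_function_def
  proof
    show "integrable (lebesgue_on D) (\<lambda>x. (norm (v x *\<^sub>R gradient f x))\<^sup>2)"
    proof (rule Bochner_Integration.integrable_bound)
      show "integrable (lebesgue_on D) (\<lambda>x. (norm (v x))\<^sup>2 * B\<^sup>2)"
        using that by (simp add: L2_function_def)
      show "AE x in lebesgue_on D. norm ((norm (v x *\<^sub>R gradient f x))\<^sup>2) \<le> norm ((norm (v x))\<^sup>2 * B\<^sup>2)"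
        using B(3) by (intro AE_I2)
          (auto simp: space_restrict_space power_mult_distrib intro!: mult_left_mono power_mono)
    qed (use L2_function_measurable[OF that] fm in measurable)
  qed (use L2_function_measurable[OF that] fm in measurable)
  have grad: "gradient (\<lambda>x. \<phi> x * f x) x = f x *\<^sub>R gradient \<phi> x + \<phi> x *\<^sub>R gradient f x"
    if "test_function D \<phi>" "x \<in> D" for \<phi> x
    by (intro gradient_mult smooth_on_has_derivative[OF fD that(2)]
        smooth_on_has_derivative[OF test_function_smooth_on[OF that(1)] that(2)])
  have L2uf: "L2_function D (\<lambda>x. u x * f x)" "L2_function D (\<lambda>x. f x *\<^sub>R g x + u x *\<^sub>R gradient f x)"
    using L2_mult[OF L2(1)] L2_function_add[OF L2_mult[OF L2(2)] L2g[OF L2(1)]] by (simp_all add: mult.commute)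
  have "has_weak_gradient D (\<lambda>x. u x * f x) (\<lambda>x. f x *\<^sub>R g x + u x *\<^sub>R gradient f x)"
    unfolding has_weak_gradient_def
  proof (intro conjI allI impI ballI)
    fix \<psi> and b :: 'a assume \<psi>: "test_function D \<psi>" and b: "b \<in> Basis"
    note \<psi>L2 = test_function_L2_function[OF D \<psi>]
    have wg: "has_weak_gradient D u g" using u by (simp add: H10_def H1_def)
    have i1: "integrable (lebesgue_on D) (\<lambda>x. u x * f x * (gradient \<psi> x \<bullet> b))"
      by (intro L2_function_integrable_mult L2_function_inner_const \<psi>L2 L2uf)
    have i2: "integrable (lebesgue_on D) (\<lambda>x. (u x *\<^sub>R gradient f x \<bullet> b) * \<psi> x)"
      by (intro L2_function_integrable_mult L2_function_inner_const \<psi>L2 L2g L2)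
    have i3: "integrable (lebesgue_on D) (\<lambda>x. (f x *\<^sub>R g x \<bullet> b) * \<psi> x)"
      by (intro L2_function_integrable_mult L2_function_inner_const \<psi>L2 L2_mult L2)
    \<comment> \<open>The weak derivative of \<open>u\<close> is tested with the product of
      \<open>\<psi>\<close> and \<open>f\<close>, itself a test function; the classical product rule
      then moves the derivative of \<open>f\<close> onto the \<open>u\<close> side.\<close>
    have "(LINT x|lebesgue_on D. u x * (gradient (\<lambda>x. \<psi> x * f x) x \<bullet> b))
        = (LINT x|lebesgue_on D. u x * f x * (gradient \<psi> x \<bullet> b) + (u x *\<^sub>R gradient f x \<bullet> b) * \<psi> x)"
      using grad[OF \<psi>] by (intro Bochner_Integration.integral_cong)
        (auto simp: space_restrict_space inner_add_left algebra_simps)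
    also have "\<dots> = (LINT x|lebesgue_on D. u x * f x * (gradient \<psi> x \<bullet> b))
        + (LINT x|lebesgue_on D. (u x *\<^sub>R gradient f x \<bullet> b) * \<psi> x)"
      using i1 i2 by (rule Bochner_Integration.integral_add)
    finally have "(LINT x|lebesgue_on D. u x * f x * (gradient \<psi> x \<bullet> b)) =
        - (LINT x|lebesgue_on D. (g x \<bullet> b) * (\<psi> x * f x)) - (LINT x|lebesgue_on D. (u x *\<^sub>R gradient f x \<bullet> b) * \<psi> x)"
      using has_weak_gradientD[OF wg test_function_mult[OF D(1) \<psi> fD] b] by simp
    also have "(LINT x|lebesgue_on D. (g x \<bullet> b) * (\<psi> x * f x)) = (LINT x|lebesgue_on D. (f x *\<^sub>R g x \<bullet> b) * \<psi> x)"
      by (simp add: mult_ac)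
    also have "- \<dots> - (LINT x|lebesgue_on D. (u x *\<^sub>R gradient f x \<bullet> b) * \<psi> x) =
        - (LINT x|lebesgue_on D. (f x *\<^sub>R g x \<bullet> b) * \<psi> x + (u x *\<^sub>R gradient f x \<bullet> b) * \<psi> x)"
      by (subst Bochner_Integration.integral_add[OF i3 i2]) simp
    finally show "(LINT x|lebesgue_on D. u x * f x * frechet_derivative \<psi> (at x) b) =
        - (LINT x|lebesgue_on D. ((f x *\<^sub>R g x + u x *\<^sub>R gradient f x) \<bullet> b) * \<psi> x)"
      using b by (simp add: gradient_inner_Basis inner_add_left distrib_right)
  qed (use L2uf D L2_function_locally_integrable in auto)
  moreover obtain \<phi> where \<phi>: "\<And>k. test_function D (\<phi> k)"
    and lim: "(\<lambda>k. LINT x|lebesgue_on D. (u x - \<phi> k x)\<^sup>2) \<longlonglongrightarrow> 0"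
    "(\<lambda>k. LINT x|lebesgue_on D. (norm (g x - gradient (\<phi> k) x))\<^sup>2) \<longlonglongrightarrow> 0"
    by (rule H10_approximation[OF D u]) blast
  have "(\<lambda>k. LINT x|lebesgue_on D. (u x * f x - \<phi> k x * f x)\<^sup>2 +
      (norm (f x *\<^sub>R g x + u x *\<^sub>R gradient f x - gradient (\<lambda>x. \<phi> k x * f x) x))\<^sup>2) \<longlonglongrightarrow> 0"
  proof (rule tendsto_sandwich[OF _ _ tendsto_const])
    let ?E = "\<lambda>k x. (u x * f x - \<phi> k x * f x)\<^sup>2 +
      (norm (f x *\<^sub>R g x + u x *\<^sub>R gradient f x - gradient (\<lambda>x. \<phi> k x * f x) x))\<^sup>2"
    \<comment> \<open>One \<open>B\<^sup>2\<close> comes from the difference of the functions; the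
      other terms, twice \<open>B\<^sup>2\<close> each, come from splitting the gradient difference
      into \<open>?p\<close> and \<open>?q\<close>.\<close>
    let ?F = "\<lambda>k x. 3 * B\<^sup>2 * (u x - \<phi> k x)\<^sup>2 + 2 * B\<^sup>2 * (norm (g x - gradient (\<phi> k) x))\<^sup>2"
    let ?b = "\<lambda>k. 3 * B\<^sup>2 * (LINT x|lebesgue_on D. (u x - \<phi> k x)\<^sup>2) +
      2 * B\<^sup>2 * (LINT x|lebesgue_on D. (norm (g x - gradient (\<phi> k) x))\<^sup>2)"
    show "?b \<longlonglongrightarrow> 0"
      using lim by (auto intro!: tendsto_eq_intros)
    show "\<forall>\<^sub>F k in sequentially. 0 \<le> (LINT x|lebesgue_on D. ?E k x)"
      by (intro always_eventually allI Bochner_Integration.integral_nonneg) simp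
    have "(LINT x|lebesgue_on D. ?E k x) \<le> ?b k" for k
    proof -
      have i: "integrable (lebesgue_on D) (\<lambda>x. (u x - \<phi> k x)\<^sup>2)"
        "integrable (lebesgue_on D) (\<lambda>x. (norm (g x - gradient (\<phi> k) x))\<^sup>2)"
        using L2_function_square_integrable[OF L2_function_diff[OF L2(1) test_function_L2_function(1)[OF D \<phi>]], of k]
          L2_function_square_integrable[OF L2_function_diff[OF L2(2) test_function_L2_function(2)[OF D \<phi>]], of k]
        by simp_all
      have pt: "?E k x \<le> ?F k x" if x: "x \<in> D" for x
      proof -
        let ?p = "f x *\<^sub>R (g x - gradient (\<phi> k) x)" and ?q = "(u x - \<phi> k x) *\<^sub>R gradient f x"
        have f2: "(f x)\<^sup>2 \<le> B\<^sup>2" "(norm (gradient f x))\<^sup>2 \<le> B\<^sup>2"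
          using B x by (auto simp: abs_le_square_iff[symmetric] intro!: power_mono)
        have 1: "(u x * f x - \<phi> k x * f x)\<^sup>2 = (f x)\<^sup>2 * (u x - \<phi> k x)\<^sup>2"
          by (simp add: power2_eq_square algebra_simps)
        have 2: "f x *\<^sub>R g x + u x *\<^sub>R gradient f x - gradient (\<lambda>x. \<phi> k x * f x) x = ?p + ?q"
          using grad[OF \<phi> x] by (simp add: algebra_simps)
        \<comment> \<open>Parallelogram law with the nonnegative term |?p - ?q|^2 dropped.\<close>
        have 3: "(norm (?p + ?q))\<^sup>2 \<le> 2 * (norm ?p)\<^sup>2 + 2 * (norm ?q)\<^sup>2"
          using inner_ge_zero[of "?p - ?q"]
          unfolding power2_norm_eq_inner by (simp only: inner_diff inner_add inner_commute)
        have 4: "(norm ?p)\<^sup>2 \<le> B\<^sup>2 * (norm (g x - gradient (\<phi> k) x))\<^sup>2"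
          "(norm ?q)\<^sup>2 \<le> (u x - \<phi> k x)\<^sup>2 * B\<^sup>2"
          using f2 by (simp_all add: power_mult_distrib mult_right_mono mult_left_mono)
        have "?E k x \<le> B\<^sup>2 * (u x - \<phi> k x)\<^sup>2
            + (2 * (B\<^sup>2 * (norm (g x - gradient (\<phi> k) x))\<^sup>2) + 2 * ((u x - \<phi> k x)\<^sup>2 * B\<^sup>2))"
          unfolding 1 2 using f2 4
          by (intro add_mono[OF _ order_trans[OF 3 add_mono]] mult_right_mono mult_left_mono) simp_all
        then show ?thesis by (simp add: algebra_simps)
      qed
      have "(LINT x|lebesgue_on D. ?E k x) \<le> (LINT x|lebesgue_on D. ?F k x)"
      proof (rule integral_mono')
        show "integrable (lebesgue_on D) (?F k)" using i by simp
        show "?E k x \<le> ?F k x" if "x \<in> space (lebesgue_on D)" for x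
          using pt that by (simp add: space_restrict_space)
      qed simp
      also have "\<dots> = ?b k" using i by simp
      finally show ?thesis .
    qed
    then show "\<forall>\<^sub>F k in sequentially. (LINT x|lebesgue_on D. ?E k x) \<le> ?b k" by simp
  qed
  ultimately show ?thesis
    unfolding H10_def H1_def using L2uf test_function_mult[OF D(1) \<phi> fD]
    by (intro conjI exI[of _ "\<lambda>k x. \<phi> k x * f x"]) auto
qed

text \<open>The integrand is the derivative of \<open>f u\<^sup>2\<close> in direction
  \<open>b\<close>. Splitting it as u times the derivative of u f, plus u f times the derivative of
  u, keeps every factor in L2, and integration by parts cancels the two halves.\<close>

lemma H10_null_Lagrangian:
  assumes D: "open D" "bounded D" and S: "closure D \<subseteq> S" and u: "H10 D u g" and f: "smooth_on S f"
    and b: "b \<in> Basis"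
  shows "integrable (lebesgue_on D) (\<lambda>x. 2 * f x * u x * (g x \<bullet> b) + (u x)\<^sup>2 * (gradient f x \<bullet> b))" (is ?int)
    and "(LINT x|lebesgue_on D. 2 * f x * u x * (g x \<bullet> b) + (u x)\<^sup>2 * (gradient f x \<bullet> b)) = 0" (is ?eq)
proof -
  note uf = H10_mult_smooth[OF D S u f]
  have L2: "L2_function D u" "L2_function D g" "L2_function D (\<lambda>x. u x * f x)"
    "L2_function D (\<lambda>x. f x *\<^sub>R g x + u x *\<^sub>R gradient f x)"
    using u uf by (auto simp: H10_def H1_def)
  have i: "integrable (lebesgue_on D) (\<lambda>x. u x * ((f x *\<^sub>R g x + u x *\<^sub>R gradient f x) \<bullet> b))"
    "integrable (lebesgue_on D) (\<lambda>x. (g x \<bullet> b) * (u x * f x))"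
    by (intro L2_function_integrable_mult L2_function_inner_const L2)+
  have eq: "2 * f x * u x * (g x \<bullet> b) + (u x)\<^sup>2 * (gradient f x \<bullet> b) =
      u x * ((f x *\<^sub>R g x + u x *\<^sub>R gradient f x) \<bullet> b) + (g x \<bullet> b) * (u x * f x)" for x
    by (simp add: inner_add_left power2_eq_square algebra_simps)
  show ?int unfolding eq using i by (rule Bochner_Integration.integrable_add)
  have "H1 D u g" using u by (simp add: H10_def)
  then show ?eq
    unfolding eq Bochner_Integration.integral_add[OF i]
    using H1_H10_integral_by_parts[OF D _ uf b] by simp
qed

subsection \<open>The unit cube\<close>

lemma unit_cube_eq_box: "unit_cube = box 0 (1 :: real ^ 'n)"
  by (auto simp: unit_cube_def mem_box_cart)

lemma open_unit_cube: "open (unit_cube :: (real ^ 'n) set)"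
  and bounded_unit_cube: "bounded (unit_cube :: (real ^ 'n) set)"
  by (auto simp: unit_cube_eq_box)

lemma sets_lebesgue_unit_cube: "(unit_cube :: (real ^ 'n) set) \<in> sets lebesgue"
  by (rule fmeasurableD[OF lmeasurable_open[OF bounded_unit_cube open_unit_cube]])

lemma closure_unit_cube: "closure unit_cube \<subseteq> cbox 0 (1 :: real ^ 'n)"
  unfolding unit_cube_eq_box by (rule closure_minimal[OF box_subset_cbox closed_cbox])

text \<open>A point at distance less than \<open>s\<close> from \<open>x\<close> still has all
  coordinates strictly between 0 and 1, so it lies in the open cube and hence off its
  frontier.\<close>

lemma infdist_frontier_unit_cube:
  fixes x :: "real ^ 'n"
  assumes "\<And>k. s \<le> x $ k" "\<And>k. x $ k \<le> 1 - s"
  shows "s \<le> infdist x (frontier unit_cube)"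
proof -
  \<comment> \<open>The frontier must be shown nonempty, because \<open>infdist\<close> to the empty
    set is 0 by default.\<close>
  have "(\<chi> k. 1 / 2) \<in> (unit_cube :: (real ^ 'n) set)" "(0 :: real ^ 'n) \<notin> unit_cube"
    by (auto simp: unit_cube_def)
  then have ne: "frontier (unit_cube :: (real ^ 'n) set) \<noteq> {}"
    by (auto simp: frontier_eq_empty)
  have "s \<le> dist x y" if "y \<in> frontier unit_cube" for y
  proof (rule ccontr)
    assume *: "\<not> s \<le> dist x y"
    have "0 < y $ k \<and> y $ k < 1" for k
      using * assms[of k] component_le_norm_cart[of "x - y" k] by (auto simp: dist_norm)
    then have "y \<in> unit_cube" by (simp add: unit_cube_def)
    then show False using that by (simp add: frontier_def interior_open[OF open_unit_cube])
  qed
  then show ?thesis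
    unfolding infdist_notempty[OF ne] by (intro cINF_greatest ne)
qed

section \<open>Integrability of the singular majorant near an edge\<close>

lemma nn_integral_powr_unit_interval:
  assumes "q < 1"
  shows "(\<integral>\<^sup>+t. ennreal (indicator {0<..<1} t * t powr (- q)) \<partial>lborel) < \<infinity>"
proof -
  have "((\<lambda>t. t powr (- q)) has_integral (1 powr (- q + 1) / (- q + 1))) {0..1::real}"
    using assms by (intro has_integral_powr_from_0) auto
  then have "((\<lambda>t. t powr (- q)) has_integral (1 powr (- q + 1) / (- q + 1))) {0<..<1::real}"
    using has_integral_Icc_iff_Ioo by blast
  then have "((\<lambda>t. indicator {0<..<1} t * t powr (- q)) has_integral (1 powr (- q + 1) / (- q + 1))) UNIV"
    by (subst (asm) has_integral_restrict_UNIV[symmetric])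
      (auto elim!: has_integral_eq[rotated] simp: indicator_def)
  then have "(\<integral>\<^sup>+t. ennreal (indicator {0<..<1} t * t powr (- q)) \<partial>lborel) = ennreal (1 powr (- q + 1) / (- q + 1))"
    by (intro nn_integral_has_integral_lborel) (auto simp: indicator_def)
  then show ?thesis by simp
qed

text \<open>The integrand, indicator included, is a product of functions of single coordinates, so
  its integral is a product of one-dimensional ones. With q = p - 1 it will dominate
  \<open>R powr (1 - p)\<close> independently of the shift.\<close>

lemma integrable_powr_mult_powr_unit_cube:
  fixes i j :: "'n::finite"
  assumes "i \<noteq> j" "q < 1"
  shows "integrable lborel (\<lambda>x :: real ^ 'n. indicator unit_cube x * ((x $ i) powr (- q) * (x $ j) powr (- q)))"
proof (rule integrableI_nonneg)
  let ?F = "\<lambda>x :: real ^ 'n. indicator unit_cube x * ((x $ i) powr (- q) * (x $ j) powr (- q))"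
  define h :: "'n \<Rightarrow> real \<Rightarrow> ennreal" where
    "h k t = ennreal (indicator {0<..<1} t * (if k = i \<or> k = j then t powr (- q) else 1))" for k t
  \<comment> \<open>The family \<open>h\<close>, reindexed by basis vectors to match the product
    formula for \<open>lborel\<close>; \<open>h i\<close> and \<open>h j\<close> are the same
    function.\<close>
  define f :: "real ^ 'n \<Rightarrow> real \<Rightarrow> ennreal" where
    "f b = (if b = axis i 1 \<or> b = axis j 1 then h i else (\<lambda>t. indicator {0<..<1} t))" for b
  have fh: "f (axis k 1) t = h k t" for k t
    by (auto simp: f_def h_def axis_eq_axis ennreal_indicator)
  have bas: "Basis = (\<lambda>k. axis k (1::real)) ` (UNIV :: 'n set)"
    by (auto simp: Basis_vec_def)
  have inj: "inj (\<lambda>k. axis k (1::real) :: real ^ 'n)"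
    by (auto simp: inj_def axis_eq_axis)
  have prod: "ennreal (?F x) = (\<Prod>b\<in>Basis. f b (x \<bullet> b))" for x
  proof -
    have "(\<Prod>b\<in>Basis. f b (x \<bullet> b)) = (\<Prod>k\<in>UNIV. h k (x $ k))"
      unfolding bas by (subst prod.reindex[OF inj]) (simp add: fh inner_axis)
    also have "\<dots> = ennreal (\<Prod>k\<in>UNIV. indicator {0<..<1} (x $ k) * (if k = i \<or> k = j then (x $ k) powr (- q) else 1))"
      unfolding h_def by (rule prod_ennreal) auto
    also have "(\<Prod>k\<in>UNIV. indicator {0<..<1} (x $ k) * (if k = i \<or> k = j then (x $ k) powr (- q) else 1)) =
       (\<Prod>k\<in>UNIV. indicator {0<..<1} (x $ k)) * (\<Prod>k\<in>UNIV. if k = i \<or> k = j then (x $ k) powr (- q) else 1)"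
      by (rule prod.distrib)
    also have "(\<Prod>k\<in>UNIV. if k = i \<or> k = j then (x $ k) powr (- q) else 1) = (x $ i) powr (- q) * (x $ j) powr (- q)"
    proof -
      have "(\<Prod>k\<in>UNIV. if k = i \<or> k = j then (x $ k) powr (- q) else 1) = (\<Prod>k\<in>{i, j}. (x $ k) powr (- q))"
        by (subst prod.mono_neutral_cong_right[of UNIV "{i, j}"]) auto
      then show ?thesis using assms(1) by simp
    qed
    also have "(\<Prod>k\<in>UNIV. indicator {0<..<1} (x $ k)) = (indicator unit_cube x :: real)"
    proof (cases "x \<in> unit_cube")
      case True
      then show ?thesis by (simp add: unit_cube_def)
    next
      case False
      then obtain k where "x $ k \<notin> {0<..<1}" by (auto simp: unit_cube_def)
      then have "(\<Prod>k\<in>UNIV. indicator {0<..<1} (x $ k)) = (0 :: real)"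
        by (intro prod_zero bexI[of _ k]) simp_all
      then show ?thesis using False by simp
    qed
    finally show ?thesis by simp
  qed
  have m: "f b \<in> borel_measurable borel" for b
    unfolding f_def h_def by simp
  have fin: "(\<integral>\<^sup>+t. f b t \<partial>lborel) < \<infinity>" for b
    using nn_integral_powr_unit_interval[OF assms(2)] by (auto simp: f_def h_def[abs_def])
  have "(\<integral>\<^sup>+x. ennreal (?F x) \<partial>lborel) = (\<Prod>b\<in>Basis. (\<integral>\<^sup>+t. f b t \<partial>lborel))"
    unfolding prod by (rule nn_integral_lborel_prod) (use m in auto)
  also have "\<dots> < \<infinity>"
    using fin by (auto simp: ennreal_prod_eq_top less_top[symmetric])
  finally show "(\<integral>\<^sup>+x. ennreal (?F x) \<partial>lborel) < \<infinity>" .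
  have "unit_cube \<in> sets (borel :: (real ^ 'n) measure)" by (rule borel_open[OF open_unit_cube])
  then show "?F \<in> borel_measurable lborel" by simp
qed (auto simp: indicator_def)

subsection \<open>The weighted energy estimate\<close>

text \<open>The left side is the divergence, divided by \<open>w\<close>, of the field with
  components \<open>F\<close> and \<open>G\<close> defined below. The two squares are those needed
  to complete the square in the energy density; what remains is the Hardy potential with constant 4
  - p^2.\<close>

lemma edge_divergence_identity:
  fixes X Y p :: real
  assumes "X > 0" "Y > 0" and R: "R = X\<^sup>2 + Y\<^sup>2"
  shows "(2 / R - 4 * X\<^sup>2 / R\<^sup>2 + 1 / X\<^sup>2 - 2 * p * X / R * (2 * X / R - 1 / X)) +
      (2 / R - 4 * Y\<^sup>2 / R\<^sup>2 + 1 / Y\<^sup>2 - 2 * p * Y / R * (2 * Y / R - 1 / Y)) =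
    ((2 - p) * X / R - 1 / X)\<^sup>2 + ((2 - p) * Y / R - 1 / Y)\<^sup>2 + (4 - p\<^sup>2) / R"
proof -
  \<comment> \<open>With the reciprocals as independent variables, the claim is polynomial modulo
    the three relations in \<open>h\<close>.\<close>
  define r I J where "r = 1 / R" and "I = 1 / X" and "J = 1 / Y"
  have "R > 0" unfolding R using assms by (intro add_pos_pos) auto
  then have h: "r * (X\<^sup>2 + Y\<^sup>2) = 1" "X * I = 1" "Y * J = 1"
    using assms by (auto simp: r_def I_def J_def)
  have "(2 * r - 4 * X\<^sup>2 * r\<^sup>2 + I\<^sup>2 - 2 * p * X * r * (2 * X * r - I)) +
      (2 * r - 4 * Y\<^sup>2 * r\<^sup>2 + J\<^sup>2 - 2 * p * Y * r * (2 * Y * r - J)) =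
    ((2 - p) * X * r - I)\<^sup>2 + ((2 - p) * Y * r - J)\<^sup>2 + (4 - p\<^sup>2) * r"
    using h by algebra
  then show ?thesis by (simp add: r_def I_def J_def power_divide)
qed

text \<open>The bound p < 2 serves twice: it makes the Hardy constant 4 - p^2 positive, and it keeps
  the exponent p - 1 of the integrable majorant below 1.\<close>

locale cube_edge =
  fixes i j :: "'n::finite" and e p :: real
  assumes ij: "i \<noteq> j" and e: "0 < e" and p: "1 < p" "p < 2"
begin

definition "X x = x $ i + e" for x :: "real ^ 'n"
definition "Y x = x $ j + e" for x :: "real ^ 'n"
definition "R x = (X x)\<^sup>2 + (Y x)\<^sup>2"
definition "w x = R x powr (- p)"
definition "S = {x. X x > 0 \<and> Y x > 0}"
text \<open>
  \<open>F\<close> and \<open>G\<close> are the components of \<open>- w \<nabla>h / h - \<nabla>w / 2\<close>, where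
  \<open>h = (X\<^sup>2 + Y\<^sup>2) powr (p / 2 - 1) * X * Y\<close> is the optimal function for the Hardy inequality
  with weight \<open>w\<close> in a quadrant.
\<close>

definition "F x = w x * (2 * X x / R x - 1 / X x)"
definition "G x = w x * (2 * Y x / R x - 1 / Y x)"

lemma open_S: "open S"
  unfolding S_def X_def Y_def by (intro open_Collect_conj open_Collect_less continuous_intros)

text \<open>The purpose of the shift e > 0: the singularities of \<open>w\<close>, \<open>F\<close>
  and \<open>G\<close> are moved off the closed cube, so these are admissible multipliers.\<close>

lemma closure_subset_S: "closure unit_cube \<subseteq> S"
proof
  fix x :: "real ^ 'n" assume "x \<in> closure unit_cube"
  with closure_unit_cube have "x \<in> cbox 0 1" by blast
  then show "x \<in> S" using e by (simp add: S_def X_def Y_def mem_box_cart add_nonneg_pos)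
qed

lemma unit_cube_subset_S: "unit_cube \<subseteq> S"
  using closure_subset closure_subset_S by blast

lemma pos: assumes "x \<in> S" shows "X x > 0" "Y x > 0" "R x > 0" "w x > 0"
proof -
  show XY: "X x > 0" "Y x > 0" using assms by (auto simp: S_def)
  then show "R x > 0" unfolding R_def by (intro add_pos_pos) auto
  then show "w x > 0" by (simp add: w_def)
qed

lemma smooth_X: "smooth_on S X" and smooth_Y: "smooth_on S Y"
proof -
  have "smooth_on S (\<lambda>x. x \<bullet> axis k 1 + e)" for k
    by (intro smooth_on_add smooth_on_inner_left smooth_on_const open_S)
  then show "smooth_on S X" "smooth_on S Y"
    unfolding X_def[abs_def] Y_def[abs_def] inner_axis by simp_all
qed

lemma smooth_R_powr: "smooth_on S (\<lambda>x. R x powr a)"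
proof (rule smooth_on_powr[OF open_S pos(3)])
  show "smooth_on S R"
    unfolding R_def[abs_def] power2_eq_square
    by (intro smooth_on_add smooth_on_mult open_S smooth_X smooth_Y)
qed

lemma smooth_w: "smooth_on S w"
  unfolding w_def[abs_def] by (rule smooth_R_powr)

lemma smooth_edge_field:
  assumes "smooth_on S Z" "\<And>x. x \<in> S \<Longrightarrow> Z x > 0"
  shows "smooth_on S (\<lambda>x. w x * (2 * Z x / R x - 1 / Z x))"
proof (rule smooth_on_cong[OF open_S])
  show "smooth_on S (\<lambda>x. w x * (2 * Z x * R x powr (-1) + (-1) * Z x powr (-1)))"
    by (intro smooth_on_mult smooth_on_add smooth_on_const smooth_on_powr smooth_R_powr smooth_w
        open_S assms)
  show "w x * (2 * Z x * R x powr (-1) + (-1) * Z x powr (-1)) = w x * (2 * Z x / R x - 1 / Z x)"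
    if "x \<in> S" for x
    using pos(3)[OF that] assms(2)[OF that] by (simp add: powr_minus divide_inverse)
qed

lemma smooth_F: "smooth_on S F" and smooth_G: "smooth_on S G"
  unfolding F_def[abs_def] G_def[abs_def]
  by (intro smooth_edge_field smooth_X smooth_Y pos; assumption)+

lemma has_derivative_X: "(X has_derivative (\<lambda>h. h $ i)) (at x)"
  and has_derivative_Y: "(Y has_derivative (\<lambda>h. h $ j)) (at x)"
  unfolding X_def[abs_def] Y_def[abs_def] by (auto intro!: derivative_eq_intros bounded_linear_imp_has_derivative bounded_linear_vec_nth)

lemma has_derivative_R: "(R has_derivative (\<lambda>h. 2 * X x * h $ i + 2 * Y x * h $ j)) (at x)"
  unfolding R_def[abs_def]
  by (auto intro!: derivative_eq_intros has_derivative_X has_derivative_Y)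

lemma has_derivative_w:
  assumes "x \<in> S"
  shows "(w has_derivative (\<lambda>h. - 2 * p * w x / R x * (X x * h $ i + Y x * h $ j))) (at x)"
  unfolding w_def[abs_def] using pos(3)[OF assms]
  by (auto intro!: derivative_eq_intros has_derivative_R simp: field_simps)

lemma gradient_w:
  "x \<in> S \<Longrightarrow> gradient w x \<bullet> v = - 2 * p * w x / R x * (X x * v $ i + Y x * v $ j)"
  by (rule gradient_inner[OF has_derivative_w])

lemma has_derivative_edge_field:
  assumes x: "x \<in> S" and Z: "(Z has_derivative (\<lambda>h. h $ k)) (at x)" "Z x > 0"
  shows "((\<lambda>x. w x * (2 * Z x / R x - 1 / Z x)) has_derivative
    (\<lambda>h. w x * ((2 * h $ k * R x - 2 * Z x * (2 * X x * h $ i + 2 * Y x * h $ j)) / (R x)\<^sup>2 + h $ k / (Z x)\<^sup>2)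
      + (- 2 * p * w x / R x * (X x * h $ i + Y x * h $ j)) * (2 * Z x / R x - 1 / Z x))) (at x)"
proof -
  have 1: "((\<lambda>x. 2 * Z x / R x) has_derivative
      (\<lambda>h. (2 * h $ k * R x - 2 * Z x * (2 * X x * h $ i + 2 * Y x * h $ j)) / (R x)\<^sup>2)) (at x)"
    using pos(3)[OF x]
    by (auto intro!: derivative_eq_intros has_derivative_R Z(1) simp: power2_eq_square)
  have 2: "((\<lambda>x. 1 / Z x) has_derivative (\<lambda>h. - (h $ k / (Z x)\<^sup>2))) (at x)"
    using Z(2) by (auto intro!: derivative_eq_intros Z(1) simp: power2_eq_square)
  show ?thesis
    using has_derivative_mult[OF has_derivative_w[OF x] has_derivative_diff[OF 1 2]] by simp
qed

text \<open>Only this entry of the Jacobian enters the divergence of the field with \<open>F\<close>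
  along coordinate \<open>i\<close> and \<open>G\<close> along \<open>j\<close>. As i \<noteq> j,
  moving along \<open>i\<close> leaves \<open>Y\<close> fixed.\<close>

lemma gradient_F:
  assumes "x \<in> S"
  shows "gradient F x \<bullet> axis i 1 =
    w x * (2 / R x - 4 * (X x)\<^sup>2 / (R x)\<^sup>2 + 1 / (X x)\<^sup>2 - 2 * p * X x / R x * (2 * X x / R x - 1 / X x))"
proof -
  note gradient_inner[OF has_derivative_edge_field[OF assms has_derivative_X pos(1)[OF assms], folded F_def], of "axis i 1"]
  moreover have "axis i (1::real) $ j = 0" using ij by (simp add: axis_def)
  ultimately show ?thesis
    using pos[OF assms] by (simp add: power2_eq_square field_simps)
qed

lemma gradient_G:
  assumes "x \<in> S"
  shows "gradient G x \<bullet> axis j 1 =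
    w x * (2 / R x - 4 * (Y x)\<^sup>2 / (R x)\<^sup>2 + 1 / (Y x)\<^sup>2 - 2 * p * Y x / R x * (2 * Y x / R x - 1 / Y x))"
proof -
  note gradient_inner[OF has_derivative_edge_field[OF assms has_derivative_Y pos(2)[OF assms], folded G_def], of "axis j 1"]
  moreover have "axis j (1::real) $ i = 0" using ij by (simp add: axis_def)
  ultimately show ?thesis
    using pos[OF assms] by (simp add: power2_eq_square field_simps)
qed

lemma sum_squares_le_norm: "(v $ i)\<^sup>2 + (v $ j)\<^sup>2 \<le> (norm (v :: real ^ 'n))\<^sup>2"
proof -
  have "(v $ i)\<^sup>2 + (v $ j)\<^sup>2 = (\<Sum>k\<in>{i, j}. (v $ k)\<^sup>2)" using ij by simp
  also have "\<dots> \<le> (\<Sum>k\<in>UNIV. (v $ k)\<^sup>2)" by (rule sum_mono2) auto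
  also have "\<dots> = (norm v)\<^sup>2" unfolding power2_norm_eq_inner inner_vec_def by (simp add: power2_eq_square)
  finally show ?thesis .
qed

section \<open>Pointwise inequalities for the densities\<close>

text \<open>The right side is the tested energy density plus two null Lagrangian densities.
  Completing squares in \<open>v $ i\<close> and \<open>v $ j\<close> leaves the nonnegative
  contribution of the other components of \<open>v\<close> and, by
  \<open>edge_divergence_identity\<close>, the Hardy term.\<close>

lemma energy_density_lower_bound:
  fixes v :: "real ^ 'n" and u :: real
  assumes x: "x \<in> S"
  shows "(4 - p\<^sup>2) * (u\<^sup>2 * (w x / R x)) \<le>
    w x * (norm v)\<^sup>2 + u * (gradient w x \<bullet> v)
    + (2 * F x * u * (v \<bullet> axis i 1) + u\<^sup>2 * (gradient F x \<bullet> axis i 1))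
    + (2 * G x * u * (v \<bullet> axis j 1) + u\<^sup>2 * (gradient G x \<bullet> axis j 1))"
proof -
  \<comment> \<open>\<open>A\<close> and \<open>B\<close> are the components of minus the
    logarithmic gradient of the function \<open>h\<close> described with \<open>F\<close> and
    \<open>G\<close>; equivalently, \<open>w A\<close> and \<open>w B\<close> are \<open>F\<close>
    and \<open>G\<close> plus half the gradient of \<open>w\<close>.\<close>
  define A B K where "A = (2 - p) * X x / R x - 1 / X x" and "B = (2 - p) * Y x / R x - 1 / Y x"
    and "K = (4 - p\<^sup>2) / R x"
  note P = pos[OF x]
  have 1: "u * (gradient w x \<bullet> v) + 2 * F x * u * (v $ i) + 2 * G x * u * (v $ j)
      = w x * (2 * u * v $ i * A + 2 * u * v $ j * B)"
    unfolding gradient_w[OF x] F_def G_def A_def B_def using P by (simp add: field_simps)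
  have 2: "gradient F x \<bullet> axis i 1 + gradient G x \<bullet> axis j 1 = w x * (A\<^sup>2 + B\<^sup>2 + K)"
    unfolding gradient_F[OF x] gradient_G[OF x] distrib_left[symmetric] A_def B_def K_def
    using edge_divergence_identity[OF P(1,2) R_def, of p] by simp
  have "w x * (norm v)\<^sup>2 + u * (gradient w x \<bullet> v)
    + (2 * F x * u * (v \<bullet> axis i 1) + u\<^sup>2 * (gradient F x \<bullet> axis i 1))
    + (2 * G x * u * (v \<bullet> axis j 1) + u\<^sup>2 * (gradient G x \<bullet> axis j 1))
    = w x * (norm v)\<^sup>2 + (u * (gradient w x \<bullet> v) + 2 * F x * u * (v $ i) + 2 * G x * u * (v $ j))
      + u\<^sup>2 * (gradient F x \<bullet> axis i 1 + gradient G x \<bullet> axis j 1)"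
    by (simp only: inner_axis inner_real_def mult_1_right distrib_left add_ac)
  also have "\<dots> = w x * (((norm v)\<^sup>2 - ((v $ i)\<^sup>2 + (v $ j)\<^sup>2)) + (v $ i + u * A)\<^sup>2 + (v $ j + u * B)\<^sup>2)
      + u\<^sup>2 * w x * K"
    unfolding 1 2 by (simp add: power2_eq_square algebra_simps)
  also have "u\<^sup>2 * w x * K = (4 - p\<^sup>2) * (u\<^sup>2 * (w x / R x))"
    by (simp add: K_def)
  finally show ?thesis
    using P(4) sum_squares_le_norm[of v] by simp
qed

text \<open>The cross term has no sign. Young's inequality absorbs twice its absolute value into one
  copy of w |v|^2, at the price of a Hardy term.\<close>

lemma gradient_density_upper_bound:
  fixes v :: "real ^ 'n" and u :: real
  assumes x: "x \<in> S"
  shows "w x * (norm v)\<^sup>2 \<le> 2 * (w x * (norm v)\<^sup>2 + u * (gradient w x \<bullet> v)) + 4 * p\<^sup>2 * (u\<^sup>2 * (w x / R x))"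
proof -
  note P = pos[OF x]
  let ?q = "X x * v $ i + Y x * v $ j"
  \<comment> \<open>Cauchy-Schwarz in the plane of the coordinates \<open>i\<close> and
    \<open>j\<close>, from Lagrange's identity.\<close>
  have "?q\<^sup>2 \<le> R x * ((v $ i)\<^sup>2 + (v $ j)\<^sup>2)"
    using zero_le_power2[of "X x * v $ j - Y x * v $ i"]
    by (simp add: R_def power2_eq_square algebra_simps)
  also have "\<dots> \<le> R x * (norm v)\<^sup>2"
    using sum_squares_le_norm P(3) by (intro mult_left_mono) auto
  finally have "?q\<^sup>2 / R x \<le> (norm v)\<^sup>2" using P(3) by (simp add: field_simps)
  moreover have "4 * p * u * ?q / R x = ?q\<^sup>2 / R x + 4 * p\<^sup>2 * u\<^sup>2 / R x - (?q - 2 * p * u)\<^sup>2 / R x"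
    using P(3) by (simp add: power2_eq_square field_simps)
  moreover have "(?q - 2 * p * u)\<^sup>2 / R x \<ge> 0" using P(3) by simp
  ultimately have "4 * p * u * ?q / R x \<le> (norm v)\<^sup>2 + 4 * p\<^sup>2 * u\<^sup>2 / R x" by linarith
  then have "w x * (4 * p * u * ?q / R x) \<le> w x * ((norm v)\<^sup>2 + 4 * p\<^sup>2 * u\<^sup>2 / R x)"
    using P(4) by (intro mult_left_mono) auto
  then show ?thesis
    unfolding gradient_w[OF x] by (simp add: algebra_simps)
qed

text \<open>Young's inequality balanced by \<open>R\<close>, together with w R =
  \<open>R powr (1 - p)\<close>. It is applied with \<open>k\<close> the Hardy constant, so that
  half of the Hardy term absorbs the first summand.\<close>

lemma source_density_upper_bound:
  fixes u :: real
  assumes x: "x \<in> S" and k: "k > 0"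
  shows "u * w x \<le> k / 2 * (u\<^sup>2 * (w x / R x)) + R x powr (1 - p) / (2 * k)"
proof -
  note P = pos[OF x]
  have "u \<le> k / 2 * (u\<^sup>2 / R x) + R x / (2 * k)"
  proof -
    have "k / 2 * (u\<^sup>2 / R x) + R x / (2 * k) - u = (k * u - R x)\<^sup>2 / (2 * k * R x)"
      using P(3) k by (simp add: power2_eq_square field_simps)
    also have "\<dots> \<ge> 0" using P(3) k by simp
    finally show ?thesis by simp
  qed
  then have "w x * u \<le> w x * (k / 2 * (u\<^sup>2 / R x) + R x / (2 * k))"
    using P(4) by (intro mult_left_mono) auto
  moreover have "R x powr (1 - p) = w x * R x"
    using P(3) by (simp add: w_def powr_diff powr_minus divide_inverse)
  ultimately show ?thesis by (simp add: algebra_simps)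
qed

section \<open>The integrated estimate, uniform in the shift\<close>

text \<open>With the integrals K, U, W, M named in the proof, the densities give \<kappa> K \<le> U
  \<le> \<kappa> K / 2 + M / (2 \<kappa>) and W \<le> 2 U + 4 p^2 K. Hence U \<le> M / \<kappa> and
  K \<le> M / \<kappa>^2, and W + U \<le> 3 U + 4 p^2 K yields the constant.\<close>

lemma weighted_energy_bound:
  fixes u :: "real ^ 'n \<Rightarrow> real"
  assumes "weak_solution unit_cube (\<lambda>_. 1) (\<lambda>_. 1) u g"
  defines "\<kappa> \<equiv> 4 - p\<^sup>2"
  shows "integrable (lebesgue_on unit_cube) (\<lambda>x. w x * ((norm (g x))\<^sup>2 + u x))" (is ?int)
    and "(LINT x|lebesgue_on unit_cube. w x * ((norm (g x))\<^sup>2 + u x))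
      \<le> (3 / \<kappa> + 4 * p\<^sup>2 / \<kappa>\<^sup>2) * (LINT x|lebesgue_on unit_cube. R x powr (1 - p))" (is ?bound)
proof -
  note D = open_unit_cube[where 'n = 'n] bounded_unit_cube[where 'n = 'n] closure_subset_S
  have \<kappa>: "\<kappa> > 0"
    using p mult_strict_mono[of p 2 p 2] by (simp add: \<kappa>_def power2_eq_square)
  have u: "H10 unit_cube u g" using assms(1) by (simp add: weak_solution_def)
  then have L2: "L2_function unit_cube u" "L2_function unit_cube g"
    by (auto simp: H10_def H1_def)
  note uw = H10_mult_smooth[OF D u smooth_w]
  have inS: "x \<in> S" if "x \<in> space (lebesgue_on unit_cube)" for x
    using that unit_cube_subset_S by (auto simp: space_restrict_space)
  let ?M = "lebesgue_on (unit_cube :: (real ^ 'n) set)"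
  let ?e = "\<lambda>x. w x * (norm (g x))\<^sup>2 + u x * (gradient w x \<bullet> g x)"
  let ?k = "\<lambda>x. (u x)\<^sup>2 * (w x / R x)"
  let ?f = "\<lambda>x. 2 * F x * u x * (g x \<bullet> axis i 1) + (u x)\<^sup>2 * (gradient F x \<bullet> axis i 1)"
  let ?g = "\<lambda>x. 2 * G x * u x * (g x \<bullet> axis j 1) + (u x)\<^sup>2 * (gradient G x \<bullet> axis j 1)"
  \<comment> \<open>The density in the shape demanded by \<open>weak_solution\<close> when testing
    with u w, including the coefficient 1.\<close>
  have e_eq: "?e = (\<lambda>x. 1 * (g x \<bullet> (w x *\<^sub>R g x + u x *\<^sub>R gradient w x)))"
    by (simp add: fun_eq_iff inner_add_right power2_norm_eq_inner inner_commute)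
  have e: "integrable ?M ?e" and uw_int: "integrable ?M (\<lambda>x. u x * w x)"
    and e_uw: "(LINT x|?M. ?e x) = (LINT x|?M. u x * w x)"
    unfolding e_eq using assms(1) uw by (auto simp: weak_solution_def)
  have b: "axis i 1 \<in> (Basis :: (real ^ 'n) set)" "axis j 1 \<in> (Basis :: (real ^ 'n) set)"
    by (auto simp: axis_in_Basis_iff)
  note f = H10_null_Lagrangian[OF D u smooth_F b(1)] and g = H10_null_Lagrangian[OF D u smooth_G b(2)]
  \<comment> \<open>For fixed \<open>e\<close> the weights are bounded on the cube, which gives
    integrability; uniformity in \<open>e\<close> is obtained only from the final bound.\<close>
  have k: "integrable ?M ?k"
  proof -
    have "integrable ?M (\<lambda>x. (R x powr (- p - 1) *\<^sub>R u x) * u x)"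
      by (intro L2_function_integrable_mult L2_function_scaleR_smooth[OF D smooth_R_powr] L2)
    moreover have "(R x powr (- p - 1) *\<^sub>R u x) * u x = ?k x" if "x \<in> space ?M" for x
      using pos(3)[OF inS[OF that]] by (simp add: w_def powr_diff power2_eq_square)
    ultimately show ?thesis
      by (subst Bochner_Integration.integrable_cong[OF refl, symmetric]) auto
  qed
  have wg: "integrable ?M (\<lambda>x. w x * (norm (g x))\<^sup>2)"
  proof -
    have "integrable ?M (\<lambda>x. (w x *\<^sub>R g x) \<bullet> g x)"
      by (intro L2_function_integrable_inner L2_function_scaleR_smooth[OF D smooth_w] L2)
    then show ?thesis by (simp add: power2_norm_eq_inner)
  qed
  have m: "integrable ?M (\<lambda>x. R x powr (1 - p))"
  proof -
    have "integrable ?M (\<lambda>x. R x powr (1 - p) * 1)"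
      by (intro L2_function_integrable_mult smooth_on_L2_function[OF D] smooth_R_powr smooth_on_const)
    then show ?thesis by simp
  qed
  define K U W M where "K = (LINT x|?M. ?k x)" and "U = (LINT x|?M. u x * w x)"
    and "W = (LINT x|?M. w x * (norm (g x))\<^sup>2)" and "M = (LINT x|?M. R x powr (1 - p))"
  note ef = Bochner_Integration.integrable_add[OF e f(1)]
  note ef_g = Bochner_Integration.integrable_add[OF ef g(1)]
  have "\<kappa> * K = (LINT x|?M. \<kappa> * ?k x)"
    unfolding K_def by (rule Bochner_Integration.integral_mult_right_zero[symmetric])
  also have "\<dots> \<le> (LINT x|?M. ?e x + ?f x + ?g x)"
  proof (rule integral_mono)
    show "\<kappa> * ?k x \<le> ?e x + ?f x + ?g x" if "x \<in> space ?M" for x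
      unfolding \<kappa>_def by (rule energy_density_lower_bound[OF inS[OF that]])
    show "integrable ?M (\<lambda>x. ?e x + ?f x + ?g x)"
      by (rule ef_g)
  qed (rule Bochner_Integration.integrable_mult_right[OF k])
  also have "\<dots> = (LINT x|?M. ?e x + ?f x) + (LINT x|?M. ?g x)"
    by (rule Bochner_Integration.integral_add[OF ef g(1)])
  also have "\<dots> = (LINT x|?M. ?e x) + (LINT x|?M. ?f x) + (LINT x|?M. ?g x)"
    unfolding Bochner_Integration.integral_add[OF e f(1)] ..
  also have "\<dots> = U" unfolding f(2) g(2) U_def e_uw by simp
  finally have KU: "\<kappa> * K \<le> U" .
  note km = Bochner_Integration.integrable_mult_right[OF k, of "\<kappa> / 2"]
    Bochner_Integration.integrable_divide_zero[OF m, of "2 * \<kappa>"]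
  have "U \<le> (LINT x|?M. \<kappa> / 2 * ?k x + R x powr (1 - p) / (2 * \<kappa>))"
    unfolding U_def
  proof (rule integral_mono)
    show "u x * w x \<le> \<kappa> / 2 * ?k x + R x powr (1 - p) / (2 * \<kappa>)" if "x \<in> space ?M" for x
      by (rule source_density_upper_bound[OF inS[OF that] \<kappa>])
    show "integrable ?M (\<lambda>x. \<kappa> / 2 * ?k x + R x powr (1 - p) / (2 * \<kappa>))"
      by (rule Bochner_Integration.integrable_add[OF km])
  qed (rule uw_int)
  also have "\<dots> = \<kappa> / 2 * K + M / (2 * \<kappa>)"
    unfolding Bochner_Integration.integral_add[OF km] Bochner_Integration.integral_mult_right_zero
      Bochner_Integration.integral_divide_zero K_def M_def ..
  finally have U: "U \<le> \<kappa> / 2 * K + M / (2 * \<kappa>)" .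
  note ek_summands = Bochner_Integration.integrable_mult_right[OF e, of 2]
    Bochner_Integration.integrable_mult_right[OF k, of "4 * p\<^sup>2"]
  note ek = Bochner_Integration.integrable_add[OF ek_summands]
  have "W \<le> (LINT x|?M. 2 * ?e x + 4 * p\<^sup>2 * ?k x)"
    unfolding W_def
  proof (rule integral_mono)
    show "w x * (norm (g x))\<^sup>2 \<le> 2 * ?e x + 4 * p\<^sup>2 * ?k x" if "x \<in> space ?M" for x
      by (rule gradient_density_upper_bound[OF inS[OF that]])
    show "integrable ?M (\<lambda>x. 2 * ?e x + 4 * p\<^sup>2 * ?k x)"
      by (rule ek)
  qed (use wg in simp)
  also have "\<dots> = (LINT x|?M. 2 * ?e x) + (LINT x|?M. 4 * p\<^sup>2 * ?k x)"
    by (rule Bochner_Integration.integral_add[OF ek_summands])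
  also have "\<dots> = 2 * U + 4 * p\<^sup>2 * K"
    unfolding Bochner_Integration.integral_mult_right_zero e_uw K_def U_def by simp
  finally have W: "W \<le> 2 * U + 4 * p\<^sup>2 * K" .
  have "\<kappa> * K \<le> M / \<kappa>" using KU U by (simp add: field_simps)
  then have K: "K \<le> M / \<kappa>\<^sup>2" using \<kappa> by (simp add: field_simps power2_eq_square)
  have "U \<le> M / \<kappa>" using KU U by (simp add: field_simps)
  moreover have "4 * p\<^sup>2 * K \<le> 4 * p\<^sup>2 * (M / \<kappa>\<^sup>2)" using K by (intro mult_left_mono) auto
  ultimately have "W + U \<le> 3 * (M / \<kappa>) + 4 * p\<^sup>2 * (M / \<kappa>\<^sup>2)" using W by linarith
  also have "\<dots> = (3 / \<kappa> + 4 * p\<^sup>2 / \<kappa>\<^sup>2) * M" by (simp add: field_simps)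
  finally have WU: "W + U \<le> (3 / \<kappa> + 4 * p\<^sup>2 / \<kappa>\<^sup>2) * M" .
  have eq: "w x * ((norm (g x))\<^sup>2 + u x) = w x * (norm (g x))\<^sup>2 + u x * w x" for x
    by (simp add: algebra_simps)
  show ?int unfolding eq by (intro Bochner_Integration.integrable_add wg uw_int)
  show ?bound
    unfolding eq using WU by (simp add: Bochner_Integration.integral_add[OF wg uw_int] W_def U_def M_def)
qed

text \<open>\<open>R\<close> dominates X Y and therefore the product of the unshifted coordinates.
  Since 1 - p is negative the power reverses this, and the majorant does not involve
  \<open>e\<close>.\<close>

lemma integral_R_powr_le:
  "(LINT x|lebesgue_on unit_cube. R x powr (1 - p))
    \<le> (LINT x|lborel. indicator unit_cube x * ((x $ i) powr (- (p - 1)) * (x $ j) powr (- (p - 1))))"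
proof -
  let ?F = "\<lambda>x :: real ^ 'n. indicator unit_cube x * ((x $ i) powr (- (p - 1)) * (x $ j) powr (- (p - 1)))"
  have F: "integrable lborel ?F"
    using p ij by (intro integrable_powr_mult_powr_unit_cube) auto
  note cube = sets_lebesgue_unit_cube[where 'n = 'n]
  have "(LINT x|lebesgue_on unit_cube. R x powr (1 - p)) = (LINT x|lebesgue. indicator unit_cube x *\<^sub>R R x powr (1 - p))"
    by (rule integral_restrict_space) (use cube in simp)
  also have "\<dots> \<le> (LINT x|lebesgue. ?F x)"
  proof (rule integral_mono')
    show "integrable lebesgue ?F" using F by (simp add: integrable_completion)
    show "indicator unit_cube x *\<^sub>R R x powr (1 - p) \<le> ?F x" for x
    proof (cases "x \<in> unit_cube")
      case True
      then have x: "0 < x $ i" "0 < x $ j" by (auto simp: unit_cube_def)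
      have "x $ i * x $ j \<le> X x * Y x"
        using x e by (intro mult_mono) (auto simp: X_def Y_def)
      also have "\<dots> \<le> R x"
      proof -
        have "0 \<le> X x * Y x" using x e by (simp add: X_def Y_def)
        then show ?thesis
          using sum_squares_bound[of "X x" "Y x"] unfolding R_def by linarith
      qed
      finally have "R x powr (1 - p) \<le> (x $ i * x $ j) powr (1 - p)"
        using x p by (intro powr_mono2') auto
      then show ?thesis using True x by (simp add: powr_mult)
    qed simp
  qed (auto simp: indicator_def)
  also have "\<dots> = (LINT x|lborel. ?F x)"
    using F by (intro integral_completion) auto
  finally show ?thesis .
qed

end

section \<open>Blow-up along the edge\<close>

text \<open>With the shift equal to \<open>t\<close>, the integral is restricted to a box on which
  the distance to the frontier is at least t / 2 and \<open>R\<close> is at most 8 t^2; the last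
  factor on the left is the volume of the box.\<close>

lemma edge_box_lower_bound:
  fixes i j :: "'n::finite" and u :: "real ^ 'n \<Rightarrow> real" and t p \<beta> c :: real
  assumes ij: "i \<noteq> j" and t: "0 < t" "t \<le> 1 / 4" and p: "1 < p" "p < 2" and "0 \<le> \<beta>" "0 < c"
    and int: "integrable (lebesgue_on unit_cube) (\<lambda>x. cube_edge.w i j t p x * ((norm (g x))\<^sup>2 + u x))"
    and ae: "AE x in lebesgue_on unit_cube. (norm (g x))\<^sup>2 + u x \<ge> c * infdist x (frontier unit_cube) powr \<beta>"
  shows "c * (t / 2) powr \<beta> * (8 * t\<^sup>2) powr (- p) * ((t / 2)\<^sup>2 * (1 / 2) ^ (CARD('n) - 2))
    \<le> (LINT x|lebesgue_on unit_cube. cube_edge.w i j t p x * ((norm (g x))\<^sup>2 + u x))"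
proof -
  interpret cube_edge i j t p using ij t p by unfold_locales auto
  let ?M = "lebesgue_on (unit_cube :: (real ^ 'n) set)"
  \<comment> \<open>The coordinates \<open>i\<close> and \<open>j\<close> range over [t/2, t], the
    others over [1/4, 3/4]; t \<le> 1/4 makes every face at least t/2 away.\<close>
  define a b :: "real ^ 'n" where "a = (\<chi> k. if k = i \<or> k = j then t / 2 else 1 / 4)"
    and "b = (\<chi> k. if k = i \<or> k = j then t else 3 / 4)"
  define L where "L = c * (t / 2) powr \<beta> * (8 * t\<^sup>2) powr (- p)"
  have L: "L \<ge> 0" using assms by (simp add: L_def)
  have ab: "a $ k \<le> b $ k" for k using t by (simp add: a_def b_def)
  have Q: "t / 2 \<le> x $ k \<and> x $ k \<le> 1 - t / 2" if "x \<in> cbox a b" for x k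
  proof -
    have "a $ k \<le> x $ k" "x $ k \<le> b $ k" using that by (auto simp: mem_box_cart)
    then show ?thesis using t by (auto simp: a_def b_def split: if_splits)
  qed
  have sub: "cbox a b \<subseteq> unit_cube"
  proof
    fix x assume "x \<in> cbox a b"
    from Q[OF this] t show "x \<in> unit_cube" unfolding unit_cube_def by (smt (verit) mem_Collect_eq field_sum_of_halves)
  qed
  note cube = sets_lebesgue_unit_cube[where 'n = 'n]
  have meas: "measure ?M (cbox a b) = (t / 2)\<^sup>2 * (1 / 2) ^ (CARD('n) - 2)"
  proof -
    have "measure ?M (cbox a b) = measure lborel (cbox a b)"
      using sub cube by (simp add: measure_restrict_space measure_completion)
    also have "\<dots> = (\<Prod>k\<in>UNIV. b $ k - a $ k)"
      by (rule content_cbox_cart) (use ab in \<open>auto simp: interval_ne_empty_cart\<close>)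
    also have "\<dots> = (\<Prod>k\<in>UNIV. if k \<in> {i, j} then t / 2 else 1 / 2)"
      by (intro prod.cong) (auto simp: a_def b_def)
    also have "\<dots> = (\<Prod>k\<in>{i, j}. t / 2) * (\<Prod>k\<in>UNIV - {i, j}. 1 / 2)"
      by (subst prod.If_cases) (simp_all only: finite Collect_mem_eq Int_UNIV_left Compl_eq_Diff_UNIV)
    also have "\<dots> = (t / 2)\<^sup>2 * (1 / 2) ^ (CARD('n) - 2)"
      using ij by (simp add: card_Diff_subset power2_eq_square numeral_2_eq_2)
    finally show ?thesis .
  qed
  have Qm: "cbox a b \<in> sets ?M" using sub cube by (simp add: sets_restrict_space_iff)
  have emeas: "emeasure ?M (cbox a b) < \<infinity>"
    using sub cube by (simp add: emeasure_restrict_space emeasure_lborel_cbox_finite[simplified] emeasure_completion)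
  have "L * measure ?M (cbox a b) = (LINT x|?M. L * indicator (cbox a b) x)"
    using Qm emeas sub by (simp add: Int_absorb2 space_restrict_space)
  also have "\<dots> \<le> (LINT x|?M. w x * ((norm (g x))\<^sup>2 + u x))"
  proof (rule integral_mono_AE)
    show "integrable ?M (\<lambda>x. L * indicator (cbox a b) x)"
      using Qm emeas by (simp add: integrable_real_indicator)
    show "AE x in ?M. L * indicator (cbox a b) x \<le> w x * ((norm (g x))\<^sup>2 + u x)"
      using ae
    proof (eventually_elim, goal_cases)
      case (1 x)
      show ?case
      proof (cases "x \<in> cbox a b")
        case True
        have X: "0 < X x" "X x \<le> 2 * t" "0 < Y x" "Y x \<le> 2 * t"
          using True[unfolded mem_box_cart, rule_format, of i] True[unfolded mem_box_cart, rule_format, of j] t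
          by (auto simp: X_def Y_def a_def b_def)
        have "(X x)\<^sup>2 \<le> (2 * t)\<^sup>2" "(Y x)\<^sup>2 \<le> (2 * t)\<^sup>2" using X by (intro power_mono; simp)+
        then have "R x \<le> 8 * t\<^sup>2" by (simp add: R_def power2_eq_square)
        moreover have "R x > 0" using X unfolding R_def by (intro add_pos_pos) auto
        ultimately have w: "(8 * t\<^sup>2) powr (- p) \<le> w x" unfolding w_def using p by (intro powr_mono2') auto
        have "t / 2 \<le> infdist x (frontier unit_cube)"
          using Q[OF True] by (intro infdist_frontier_unit_cube) auto
        then have "c * (t / 2) powr \<beta> \<le> c * infdist x (frontier unit_cube) powr \<beta>"
          using t assms by (intro mult_left_mono powr_mono2) auto
        with 1 have "c * (t / 2) powr \<beta> \<le> (norm (g x))\<^sup>2 + u x" by linarith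
        moreover have "0 \<le> c * (t / 2) powr \<beta>" using assms by simp
        ultimately have "L \<le> ((norm (g x))\<^sup>2 + u x) * w x"
          unfolding L_def using w by (intro mult_mono) auto
        then show ?thesis using True by (simp add: mult.commute)
      next
        case False
        \<comment> \<open>Off the box the assumed lower bound itself makes the density nonnegative,
          so discarding that region only lowers the integral.\<close>
        have "0 \<le> c * infdist x (frontier unit_cube) powr \<beta>" using assms by simp
        with 1 have "0 \<le> (norm (g x))\<^sup>2 + u x" by linarith
        then show ?thesis using False by (simp add: w_def)
      qed
    qed
  qed (rule int)
  finally show ?thesis by (simp add: meas L_def)
qed

text \<open>The lower bound on the box and the uniform weighted estimate would bound a multiple of
  \<open>t powr (\<beta> / 2 - 1)\<close> for all small t > 0, although the exponent is
  negative.\<close>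

lemma weak_solution_unit_cube_not_lower_bounded:
  fixes u :: "real ^ 'n \<Rightarrow> real"
  assumes "CARD('n) \<ge> 2" "weak_solution unit_cube (\<lambda>_. 1) (\<lambda>_. 1) u g" "0 \<le> \<beta>" "\<beta> < 2" "c > 0"
  shows "\<not> (AE x in lebesgue_on unit_cube. (norm (g x))\<^sup>2 + u x \<ge> c * infdist x (frontier unit_cube) powr \<beta>)"
proof
  assume ae: "AE x in lebesgue_on unit_cube. (norm (g x))\<^sup>2 + u x \<ge> c * infdist x (frontier unit_cube) powr \<beta>"
  obtain i j :: 'n where ij: "i \<noteq> j"
    using assms(1) by (metis card_2_iff' card_le_Suc_iff ex_card UNIV_I numeral_2_eq_2)
  \<comment> \<open>The midpoint of the interval from \<beta> / 2 + 1 to 2, which is nonempty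
    because \<beta> < 2; then \<beta> - 2 p + 2 = \<beta> / 2 - 1.\<close>
  define p where "p = (\<beta> + 6) / 4"
  have p: "1 < p" "p < 2" using assms by (auto simp: p_def)
  define m where "m = CARD('n) - 2"
  define A where "A = c * (1 / 2) powr \<beta> * 8 powr (- p) * ((1 / 2)\<^sup>2 * (1 / 2) ^ m)"
  have A: "A > 0" using assms by (simp add: A_def)
  \<comment> \<open>The bound is formed with the unshifted majorant, so \<open>C\<close> is
    independent of \<open>t\<close>.\<close>
  define C where "C = (3 / (4 - p\<^sup>2) + 4 * p\<^sup>2 / (4 - p\<^sup>2)\<^sup>2) *
    (LINT x|lborel. indicator (unit_cube :: (real ^ 'n) set) x * ((x $ i) powr (- (p - 1)) * (x $ j) powr (- (p - 1))))"
  have bound: "A * t powr (\<beta> / 2 - 1) \<le> C" if t: "0 < t" "t \<le> 1 / 4" for t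
  proof -
    interpret cube_edge i j t p using ij t p by unfold_locales auto
    have "\<beta> / 2 - 1 = \<beta> + 2 * (- p) + 2" by (simp add: p_def field_simps)
    moreover have "(t\<^sup>2) powr (- p) = t powr (2 * (- p))"
      using t by (simp add: powr_powr flip: powr_numeral)
    ultimately have "t powr (\<beta> / 2 - 1) = t powr \<beta> * (t\<^sup>2) powr (- p) * t\<^sup>2"
      using t by (simp only: powr_add) simp
    then have "A * t powr (\<beta> / 2 - 1) = c * (t / 2) powr \<beta> * (8 * t\<^sup>2) powr (- p) * ((t / 2)\<^sup>2 * (1 / 2) ^ m)"
      using t by (simp add: A_def powr_mult powr_divide power_divide)
    also have "\<dots> \<le> (LINT x|lebesgue_on unit_cube. w x * ((norm (g x))\<^sup>2 + u x))"
      unfolding m_def by (intro edge_box_lower_bound weighted_energy_bound(1) assms ij t p ae)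
    also have "\<dots> \<le> (3 / (4 - p\<^sup>2) + 4 * p\<^sup>2 / (4 - p\<^sup>2)\<^sup>2) * (LINT x|lebesgue_on unit_cube. R x powr (1 - p))"
      by (rule weighted_energy_bound(2)[OF assms(2)])
    also have "\<dots> \<le> C"
      unfolding C_def
    proof (intro mult_left_mono integral_R_powr_le)
      have "p\<^sup>2 < 4" using p mult_strict_mono[of p 2 p 2] by (simp add: power2_eq_square)
      then show "0 \<le> 3 / (4 - p\<^sup>2) + 4 * p\<^sup>2 / (4 - p\<^sup>2)\<^sup>2" by simp
    qed
    finally show ?thesis .
  qed
  define \<delta> where "\<delta> = 1 - \<beta> / 2"
  \<comment> \<open>For t = \<open>N powr (- (1 / \<delta>))\<close> the first entry ensures t \<le>
    1/4, while the second makes \<open>t powr (- \<delta>)\<close>, which equals \<open>N\<close>,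
    exceed C / A.\<close>
  define N where "N = max (4 powr \<delta>) (C / A + 1)"
  have \<delta>: "\<delta> > 0" using assms(4) by (simp add: \<delta>_def)
  have N: "4 powr \<delta> \<le> N" "C / A < N" by (auto simp: N_def)
  moreover have "0 < 4 powr \<delta>" by simp
  ultimately have "N > 0" by linarith
  have "N powr (- (1 / \<delta>)) \<le> (4 powr \<delta>) powr (- (1 / \<delta>))"
    using N(1) \<delta> by (intro powr_mono2') auto
  also have "\<dots> = 1 / 4" using \<delta> by (simp add: powr_powr powr_minus)
  finally have "A * (N powr (- (1 / \<delta>))) powr (- \<delta>) \<le> C"
    using bound[of "N powr (- (1 / \<delta>))"] \<open>N > 0\<close> by (simp add: \<delta>_def)
  then have "A * N \<le> C" using \<delta> \<open>N > 0\<close> by (simp add: powr_powr)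
  then show False using N(2) A by (simp add: field_simps)
qed

text \<open>\<open>positivity_condition\<close> quantifies existentially over weak solutions, so the
  first conjunct applies the preceding lemma to an arbitrary one; the second applies it to the given
  \<open>u\<close> and \<open>g\<close>.\<close>

theorem proposition3p6:
  fixes u :: "real ^ 'n \<Rightarrow> real" and g :: "real ^ 'n \<Rightarrow> real ^ 'n" and \<beta> :: real
  assumes "CARD('n) \<ge> 2"
    and "weak_solution unit_cube (\<lambda>_. 1) (\<lambda>_. 1) u g"
    and "0 \<le> \<beta>" and "\<beta> < 2"
  shows "\<not> positivity_condition (unit_cube :: (real ^ 'n) set) (\<lambda>_. 1) (\<lambda>_. 1) \<beta> \<and>
    \<not> (\<exists>c>0. AE x in lebesgue_on unit_cube.
          (norm (g x))\<^sup>2 + u x \<ge> c * infdist x (frontier unit_cube) powr \<beta>)"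
  using weak_solution_unit_cube_not_lower_bounded[OF assms(1) _ assms(3,4)] assms(2)
  unfolding positivity_condition_def by auto

end
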